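(* Let $$\mathcal{F}=\{T_{4,t}:5\le t\le 9\}\cup\{T_{5,t}:5\le t\le 8\}\cup\{T_{6,5},T_{6,6}\}\cup\{T_{G,2,t}:6\le t\le 8\}\cup\{T_{G,3,t}:6\le t\le 8\}.$$ If $T\in\mathcal{F}$ and $e$ is any nonedge of $T$ (a pair of distinct nonadjacent vertices), then the unicyclic graph $T+e$ obtained by adding the edge $e$ has an independence polynomial that is unimodal and not log-concave.
   Context: Graphs are finite and simple. $I(G;x)=\sum_{j=0}^{\alpha(G)}s_j(G)x^j$ is the independence polynomial, where $s_j(G)$ counts independent sets of size $j$ and $\alpha(G)$ is the independence number. A polynomial with nonnegative coefficients $(a_0,\dots,a_d)$ is unimodal if $a_0\le\cdots\le a_m\ge\cdots\ge a_d$ for some $m$, and log-concave if $a_i^2\ge a_{i-1}a_{i+1}$ for $1\le i\le d-1$. A $P_2$-arm at a vertex $w$ is a path $w\,a\,b$ with edges $wa$, $ab$ and new vertices $a,b$. Galvin's tree $T_{m,t}$ has a root $v$ with children $w_1,\dots,w_m$, and each $w_i$ carries $t$ $P_2$-arms; there are no other vertices or edges. The Bautista--Ramos tree $T_{G,m,t}$ is formed from $m$ disjoint copies of $T_{3,t}$ by making their roots adjacent to a new root $v_0$ and adding one extra leaf adjacent to $v_0$. (In $T_{G,m,t}$ the letter $G$ is just a symbol.) *)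

theory Defs
  imports "HOL-Computational_Algebra.Polynomial"
begin

text \<open>A graph is a vertex set together with a set of two-element sets of vertices.\<close>

type_synonym 'a graph = "'a set \<times> 'a set set"

abbreviation verts :: "'a graph \<Rightarrow> 'a set" where "verts \<equiv> fst"

abbreviation edges :: "'a graph \<Rightarrow> 'a set set" where "edges \<equiv> snd"

definition finite_simple_graph :: "'a graph \<Rightarrow> bool" where
  "finite_simple_graph G \<longleftrightarrow> finite (verts G) \<and> (\<forall>e\<in>edges G. e \<subseteq> verts G \<and> card e = 2)"

definition nonedge :: "'a graph \<Rightarrow> 'a set \<Rightarrow> bool" where
  "nonedge G e \<longleftrightarrow> (\<exists>u\<in>verts G. \<exists>v\<in>verts G. u \<noteq> v \<and> e = {u, v}) \<and> e \<notin> edges G"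

definition add_edge :: "'a graph \<Rightarrow> 'a set \<Rightarrow> 'a graph" where
  "add_edge G e = (verts G, insert e (edges G))"

definition independent :: "'a graph \<Rightarrow> 'a set \<Rightarrow> bool" where
  "independent G S \<longleftrightarrow> S \<subseteq> verts G \<and> (\<forall>u\<in>S. \<forall>v\<in>S. {u, v} \<notin> edges G)"

definition independence_number :: "'a graph \<Rightarrow> nat" where
  "independence_number G = Max {card S | S. independent G S}"

definition num_independent :: "'a graph \<Rightarrow> nat \<Rightarrow> nat" where
  "num_independent G j = card {S. independent G S \<and> card S = j}"

definition independence_poly :: "'a graph \<Rightarrow> nat poly" where
  "independence_poly G = (\<Sum>j=0..independence_number G. monom (num_independent G j) j)"

text \<open>
  Unimodality and log-concavity are only considered for polynomials with nonnegative
  coefficients; here this is guaranteed by taking the coefficients in the natural numbers.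
\<close>

definition unimodal :: "nat poly \<Rightarrow> bool" where
  "unimodal p \<longleftrightarrow> (\<exists>m\<le>degree p.
     (\<forall>i<m. coeff p i \<le> coeff p (i + 1)) \<and>
     (\<forall>i. m \<le> i \<and> i < degree p \<longrightarrow> coeff p i \<ge> coeff p (i + 1)))"

definition log_concave :: "nat poly \<Rightarrow> bool" where
  "log_concave p \<longleftrightarrow>
     (\<forall>i. 1 \<le> i \<and> i < degree p \<longrightarrow> (coeff p i)\<^sup>2 \<ge> coeff p (i - 1) * coeff p (i + 1))"

text \<open>
  One vertex type serves both families of trees. Galvin's tree uses the root \<open>Root\<close>, its
  children \<open>Child i\<close>, and for the \<open>j\<close>-th arm at \<open>Child i\<close> the path
  \<open>Child i\<close>, \<open>Inner i j\<close>, \<open>Outer i j\<close>. In a Bautista--Ramos tree, \<open>Copy k x\<close> is the vertex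
  \<open>x\<close> in the \<open>k\<close>-th copy of Galvin's tree, \<open>Apex\<close> is the new root and \<open>Pendant\<close> the extra leaf.
\<close>

datatype vertex =
    Root | Child nat | Inner nat nat | Outer nat nat
  | Apex | Pendant | Copy nat vertex

definition galvin_tree :: "nat \<Rightarrow> nat \<Rightarrow> vertex graph" where
  "galvin_tree m t =
    ({Root} \<union> {Child i | i. i < m}
       \<union> {Inner i j | i j. i < m \<and> j < t} \<union> {Outer i j | i j. i < m \<and> j < t},
     {{Root, Child i} | i. i < m}
       \<union> {{Child i, Inner i j} | i j. i < m \<and> j < t}
       \<union> {{Inner i j, Outer i j} | i j. i < m \<and> j < t})"

definition bautista_ramos_tree :: "nat \<Rightarrow> nat \<Rightarrow> vertex graph" where
  "bautista_ramos_tree m t =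
    ({Apex, Pendant} \<union> {Copy k x | k x. k < m \<and> x \<in> verts (galvin_tree 3 t)},
     {{Apex, Pendant}} \<union> {{Apex, Copy k Root} | k. k < m}
       \<union> {Copy k ` e | k e. k < m \<and> e \<in> edges (galvin_tree 3 t)})"

lemma finite_simple_graph_galvin_tree: "finite_simple_graph (galvin_tree m t)"
proof -
  have "verts (galvin_tree m t) = {Root} \<union> Child ` {..<m}
      \<union> case_prod Inner ` ({..<m} \<times> {..<t}) \<union> case_prod Outer ` ({..<m} \<times> {..<t})"
    by (auto simp: galvin_tree_def)
  then have "finite (verts (galvin_tree m t))"
    by simp
  then show ?thesis
    by (auto simp: finite_simple_graph_def galvin_tree_def)
qed

lemma finite_simple_graph_bautista_ramos_tree: "finite_simple_graph (bautista_ramos_tree m t)"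
proof -
  have G: "finite_simple_graph (galvin_tree 3 t)"
    by (rule finite_simple_graph_galvin_tree)
  have "verts (bautista_ramos_tree m t) =
      {Apex, Pendant} \<union> case_prod Copy ` ({..<m} \<times> verts (galvin_tree 3 t))"
    by (auto simp: bautista_ramos_tree_def)
  then have "finite (verts (bautista_ramos_tree m t))"
    using G by (simp add: finite_simple_graph_def)
  moreover have "card (Copy k ` e) = card e" for k e
    by (rule card_image) (simp add: inj_on_def)
  moreover have "Root \<in> verts (galvin_tree 3 t)"
    by (simp add: galvin_tree_def)
  ultimately show ?thesis
    using G by (fastforce simp: finite_simple_graph_def bautista_ramos_tree_def)
qed

lemma finite_simple_graph_add_edge:
  "finite_simple_graph G \<Longrightarrow> nonedge G e \<Longrightarrow> finite_simple_graph (add_edge G e)"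
  by (auto simp: finite_simple_graph_def nonedge_def add_edge_def)

end

theory Submission
  imports Defs
begin

text \<open>
  Independent sets of $T$ either avoid the edge $e = uv$ or contain both its ends, so
  $I(T+e;x) = I(T;x) - F(x)$ where $F$ counts the independent sets of $T$ containing $u$ and $v$.
  Splitting a rooted tree at its root computes both polynomials, and up to symmetry there are only
  a few possible $F$ for each tree. A branch of Galvin's tree contributes a combination of powers of
  $1+x$ and $1+2x$, so all coefficients are obtained by repeatedly multiplying by these two factors.
  Unimodality and the failure of log-concavity (near the top degree) are then checked numerically
  for each $F$.
\<close>

section \<open>Generating functions of families of finite sets\<close>

text \<open>Log-concavity fails because of the root. In \<open>galvin_tree m t\<close> an
  independent set through the root avoids all children and takes at most one of the two new vertices
  of each of the m t arms; this gives 2^(m t) sets of size m t + 1 and none larger. Sets avoiding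
  the root go up to size m (t + 1), but comparatively few of them exceed m t + 1, so the
  coefficients drop sharply there and the inequality centred at m t + 2 breaks. A new edge does not
  repair this: at most half of those 2^(m t) sets contain both of its ends. In the Bautista--Ramos
  trees the roots of the copies play the same part. The polynomial I of T + e is never computed.
  Coefficients are natural numbers, without a faithful subtraction, so I is known only through I + F
  = A, and every test is phrased in the coefficients of A and F.\<close>

definition X :: "nat poly" where "X = monom 1 1"

definition genfun :: "'a set set \<Rightarrow> nat poly" where
  "genfun F = (\<Sum>S\<in>F. X ^ card S)"

lemma coeff_X_power: "coeff (X ^ k) j = of_bool (k = j)"
  by (simp add: X_def monom_power)

lemma coeff_genfun: "finite F \<Longrightarrow> coeff (genfun F) j = card {S \<in> F. card S = j}"
  by (simp add: genfun_def coeff_sum coeff_X_power of_bool_def sum.If_cases Int_def conj_commute)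

lemma genfun_Un: "finite F \<Longrightarrow> finite F' \<Longrightarrow> F \<inter> F' = {} \<Longrightarrow> genfun (F \<union> F') = genfun F + genfun F'"
  by (simp add: genfun_def sum.union_disjoint)

lemma genfun_insert_image:
  assumes "\<And>S. S \<in> F \<Longrightarrow> finite S \<and> v \<notin> S"
  shows "genfun (insert v ` F) = X * genfun F"
proof -
  have "inj_on (insert v) F"
    using assms by (meson inj_onI insert_ident)
  then show ?thesis
    using assms by (simp add: genfun_def sum.reindex sum_distrib_left)
qed

lemma genfun_product:
  assumes "finite A" "finite B" "A \<inter> B = {}" "F \<subseteq> Pow A" "F' \<subseteq> Pow B"
  shows "genfun {S. S \<subseteq> A \<union> B \<and> S \<inter> A \<in> F \<and> S \<inter> B \<in> F'} = genfun F * genfun F'"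
proof -
  let ?G = "{S. S \<subseteq> A \<union> B \<and> S \<inter> A \<in> F \<and> S \<inter> B \<in> F'}"
  have bij: "bij_betw (\<lambda>(S, S'). S \<union> S') (F \<times> F') ?G"
  proof (rule bij_betw_byWitness[where f' = "\<lambda>S. (S \<inter> A, S \<inter> B)"])
    show "\<forall>a\<in>F \<times> F'. (\<lambda>S. (S \<inter> A, S \<inter> B)) (case a of (S, S') \<Rightarrow> S \<union> S') = a"
      using assms(3-5) by fastforce
    show "(\<lambda>(S, S'). S \<union> S') ` (F \<times> F') \<subseteq> ?G"
    proof clarsimp
      fix S S' assume "S \<in> F" "S' \<in> F'"
      moreover from this have "(S \<union> S') \<inter> A = S" "(S \<union> S') \<inter> B = S'"
        using assms(3-5) by blast+
      ultimately show "S \<subseteq> A \<union> B \<and> S' \<subseteq> A \<union> B \<and> (S \<union> S') \<inter> A \<in> F \<and> (S \<union> S') \<inter> B \<in> F'"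
        using assms(4,5) by auto
    qed
  qed (auto simp: Int_Un_distrib[symmetric])
  have "genfun ?G = (\<Sum>z\<in>F \<times> F'. X ^ card (case z of (S, S') \<Rightarrow> S \<union> S'))"
    unfolding genfun_def by (rule sum.reindex_bij_betw[OF bij, symmetric])
  also have "\<dots> = (\<Sum>(S, S')\<in>F \<times> F'. X ^ card S * X ^ card S')"
  proof (rule sum.cong[OF refl], clarsimp)
    fix S S' assume "S \<in> F" "S' \<in> F'"
    then have "card (S \<union> S') = card S + card S'"
      using assms by (intro card_Un_disjoint) (auto dest: finite_subset)
    then show "X ^ card (S \<union> S') = X ^ card S * X ^ card S'"
      by (simp add: power_add)
  qed
  also have "\<dots> = genfun F * genfun F'"
    by (simp add: genfun_def sum_product sum.cartesian_product)
  finally show ?thesis .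
qed

lemma finite_independent:
  assumes "finite_simple_graph G"
  shows "finite {S. independent G S}"
  using assms by (auto intro: finite_subset[of _ "Pow (verts G)"]
      simp: finite_simple_graph_def independent_def)

lemma independence_poly_genfun:
  assumes "finite_simple_graph G"
  shows "independence_poly G = genfun {S. independent G S}"
proof (rule poly_eqI)
  fix j
  let ?C = "{card S | S. independent G S}"
  have fin: "finite ?C"
    using finite_independent[OF assms] by simp
  have "num_independent G j = 0" if "independence_number G < j"
  proof -
    have "card S \<noteq> j" if "independent G S" for S
    proof -
      have "card S \<le> independence_number G"
        unfolding independence_number_def using that by (intro Max_ge[OF fin]) blast
      then show ?thesis
        using \<open>independence_number G < j\<close> by simp
    qed
    then have "{S. independent G S \<and> card S = j} = {}"
      by blast
    then show ?thesis
      by (simp only: num_independent_def card.empty)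
  qed
  then have "coeff (independence_poly G) j = num_independent G j"
    by (auto simp: independence_poly_def coeff_sum not_le)
  then show "coeff (independence_poly G) j = coeff (genfun {S. independent G S}) j"
    by (simp add: coeff_genfun[OF finite_independent[OF assms]] num_independent_def)
qed

lemma independence_poly_add_edge:
  assumes G: "finite_simple_graph G" and "nonedge G {u, v}"
  shows "independence_poly (add_edge G {u, v}) + genfun {S. independent G S \<and> {u, v} \<subseteq> S}
    = genfun {S. independent G S}"
proof -
  let ?H = "add_edge G {u, v}"
  have H: "finite_simple_graph ?H"
    using assms by (rule finite_simple_graph_add_edge)
  have split: "{S. independent G S} = {S. independent ?H S} \<union> {S. independent G S \<and> {u, v} \<subseteq> S}"
    by (auto simp: independent_def add_edge_def doubleton_eq_iff)
  have disj: "{S. independent ?H S} \<inter> {S. independent G S \<and> {u, v} \<subseteq> S} = {}"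
    by (auto simp: independent_def add_edge_def)
  have "finite {S. independent G S \<and> {u, v} \<subseteq> S}"
    using finite_independent[OF G] by (rule rev_finite_subset) blast
  then show ?thesis
    using genfun_Un[OF finite_independent[OF H] _ disj] split
    by (simp add: independence_poly_genfun[OF H])
qed

section \<open>Rooted trees\<close>

datatype 'a rtree = Node (root: 'a) (children: "'a rtree list")

primrec labels :: "'a rtree \<Rightarrow> 'a list" where
  "labels (Node v ts) = v # concat (map labels ts)"

fun indep :: "'a set \<Rightarrow> 'a rtree \<Rightarrow> bool" where
  "indep S (Node v ts) \<longleftrightarrow>
     (\<forall>t\<in>set ts. indep S t) \<and> (v \<in> S \<longrightarrow> (\<forall>t\<in>set ts. root t \<notin> S))"

text \<open>\<open>R\<close> is cut down to the labels of \<open>t\<close>, so that one global set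
  of required vertices can be handed unchanged to every subtree.\<close>

definition rooted :: "'a set \<Rightarrow> bool \<Rightarrow> 'a rtree \<Rightarrow> 'a set set" where
  "rooted R b t = {S. S \<subseteq> set (labels t) \<and> indep S t \<and> R \<inter> set (labels t) \<subseteq> S \<and> (root t \<in> S \<longleftrightarrow> b)}"

fun rgen :: "'a set \<Rightarrow> bool \<Rightarrow> 'a rtree \<Rightarrow> nat poly" where
  "rgen R False (Node v ts) =
     (if v \<in> R then 0 else prod_list (map (\<lambda>t. rgen R False t + rgen R True t) ts))"
| "rgen R True (Node v ts) = X * prod_list (map (rgen R False) ts)"

lemma root_in_labels [simp]: "root t \<in> set (labels t)"
  by (cases t) simp

lemma indep_cong: "(\<And>v. v \<in> set (labels t) \<Longrightarrow> v \<in> S \<longleftrightarrow> v \<in> S') \<Longrightarrow> indep S t = indep S' t"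
proof (induction t)
  case (Node v ts)
  have "indep S t = indep S' t" "root t \<in> S \<longleftrightarrow> root t \<in> S'" if "t \<in> set ts" for t
    using Node that by (auto intro: root_in_labels)
  then show ?case
    using Node.prems by auto
qed

lemma indep_Int_labels: "indep (S \<inter> set (labels t)) t = indep S t"
  by (rule indep_cong) auto

lemma rgen_cong: "(\<And>v. v \<in> set (labels t) \<Longrightarrow> v \<in> R \<longleftrightarrow> v \<in> R') \<Longrightarrow> rgen R b t = rgen R' b t"
proof (induction t arbitrary: b)
  case (Node v ts)
  have "rgen R b t = rgen R' b t" if "t \<in> set ts" for t b
    using Node that by auto
  then show ?case
    using Node.prems by (cases b) (auto cong: map_cong)
qed

lemma rgen_map_rtree: "rgen R b (map_rtree f t) = rgen (f -` R) b t"
  by (induction t arbitrary: b) (case_tac b; simp add: comp_def cong: map_cong)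

lemma indep_map_rtree: "indep S (map_rtree f t) = indep (f -` S) t"
  by (induction t) (simp add: rtree.map_sel)

lemma labels_map_rtree: "labels (map_rtree f t) = map f (labels t)"
  by (induction t) (simp add: map_concat comp_def cong: map_cong)

lemma genfun_forest:
  assumes "distinct (concat (map labels ts))" "\<And>t. t \<in> set ts \<Longrightarrow> F t \<subseteq> Pow (set (labels t))"
  shows "genfun {S. S \<subseteq> (\<Union>t\<in>set ts. set (labels t)) \<and> (\<forall>t\<in>set ts. S \<inter> set (labels t) \<in> F t)}
    = prod_list (map (\<lambda>t. genfun (F t)) ts)"
  using assms
proof (induction ts)
  case Nil
  then show ?case
    by (simp add: genfun_def)
next
  case (Cons t ts)
  let ?A = "set (labels t)" and ?B = "\<Union>t\<in>set ts. set (labels t)"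
  let ?F = "{S. S \<subseteq> ?B \<and> (\<forall>t\<in>set ts. S \<inter> set (labels t) \<in> F t)}"
  have "?A \<inter> ?B = {}"
    using Cons.prems(1) by auto
  then have "genfun {S. S \<subseteq> ?A \<union> ?B \<and> S \<inter> ?A \<in> F t \<and> S \<inter> ?B \<in> ?F} = genfun (F t) * genfun ?F"
    using Cons.prems(2) by (intro genfun_product) auto
  moreover have "S \<inter> ?B \<inter> set (labels t') = S \<inter> set (labels t')" if "t' \<in> set ts" for S t'
    using that by auto
  then have "{S. S \<subseteq> ?A \<union> ?B \<and> S \<inter> ?A \<in> F t \<and> S \<inter> ?B \<in> ?F} =
      {S. S \<subseteq> (\<Union>t\<in>set (t # ts). set (labels t)) \<and> (\<forall>t\<in>set (t # ts). S \<inter> set (labels t) \<in> F t)}"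
    by auto
  moreover have "genfun ?F = prod_list (map (\<lambda>t. genfun (F t)) ts)"
    using Cons by simp
  ultimately show ?case
    by simp
qed

lemma finite_rooted: "finite (rooted R b t)"
  by (rule finite_subset[of _ "Pow (set (labels t))"]) (auto simp: rooted_def)

text \<open>The subtrees interact only through \<open>v\<close>. Once it is fixed whether
  \<open>v\<close> is selected, the traces on the subtrees can be chosen independently of each
  other, and the generating functions multiply.\<close>

theorem genfun_rooted: "distinct (labels t) \<Longrightarrow> genfun (rooted R b t) = rgen R b t"
proof (induction t arbitrary: b)
  case (Node v ts)
  let ?L = "\<lambda>t. set (labels t)"
  let ?A = "\<Union>t\<in>set ts. ?L t"
  have v: "v \<notin> ?A" and dist: "distinct (concat (map labels ts))"
    using Node.prems by auto
  have IH: "genfun (rooted R c t) = rgen R c t" if "t \<in> set ts" for t c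
    using Node.IH[OF that] dist that by (auto simp: distinct_concat_iff)
  have IH': "genfun (rooted R False t \<union> rooted R True t) = rgen R False t + rgen R True t"
    if "t \<in> set ts" for t
  proof -
    have "rooted R False t \<inter> rooted R True t = {}"
      by (auto simp: rooted_def)
    then show ?thesis
      by (simp add: genfun_Un finite_rooted IH[OF that])
  qed
  have root: "root t \<in> S \<inter> ?L t \<longleftrightarrow> root t \<in> S" for t :: "'a rtree" and S
    by simp
  show ?case
  proof (cases b)
    case False
    show ?thesis
    proof (cases "v \<in> R")
      case True
      then have "rooted R False (Node v ts) = {}"
        by (auto simp: rooted_def)
      then show ?thesis
        using True False by (simp add: genfun_def)
    next
      case vR: False
      have "rooted R False (Node v ts) =
        {S. S \<subseteq> ?A \<and> (\<forall>t\<in>set ts. S \<inter> ?L t \<in> rooted R False t \<union> rooted R True t)}"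
        using v vR by (auto simp: rooted_def indep_Int_labels)
      also have "genfun \<dots> = prod_list (map (\<lambda>t. genfun (rooted R False t \<union> rooted R True t)) ts)"
        by (rule genfun_forest[OF dist]) (auto simp: rooted_def)
      finally show ?thesis
        using False vR by (simp add: IH' cong: map_cong)
    qed
  next
    case True
    let ?F = "{S. S \<subseteq> ?A \<and> (\<forall>t\<in>set ts. S \<inter> ?L t \<in> rooted R False t)}"
    have "rooted R True (Node v ts) = insert v ` ?F"
    proof (intro set_eqI iffI)
      fix S assume S: "S \<in> rooted R True (Node v ts)"
      have *: "(S - {v}) \<inter> ?L t = S \<inter> ?L t" if "t \<in> set ts" for t
        using that v by auto
      then have "indep (S - {v}) t = indep S t" if "t \<in> set ts" for t
        using that by (metis indep_Int_labels)
      then have "S - {v} \<in> ?F"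
        using S v * by (auto simp: rooted_def indep_Int_labels)
      moreover have "S = insert v (S - {v})"
        using S by (auto simp: rooted_def)
      ultimately show "S \<in> insert v ` ?F"
        by blast
    next
      fix S assume "S \<in> insert v ` ?F"
      then obtain S' where S': "S' \<in> ?F" "S = insert v S'"
        by blast
      have "S \<inter> ?L t = S' \<inter> ?L t" if "t \<in> set ts" for t
        using that v S'(2) by auto
      then have *: "S \<inter> ?L t \<in> rooted R False t" if "t \<in> set ts" for t
        using that S'(1) by simp
      then have "indep S t" "root t \<notin> S" "R \<inter> ?L t \<subseteq> S" if "t \<in> set ts" for t
        using *[OF that] by (auto simp: rooted_def indep_Int_labels)
      then show "S \<in> rooted R True (Node v ts)"
        using S' by (auto simp: rooted_def)
    qed
    moreover have "genfun (insert v ` ?F) = X * genfun ?F"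
      using v by (intro genfun_insert_image) (auto intro: finite_subset[of _ ?A])
    moreover have "genfun ?F = prod_list (map (\<lambda>t. genfun (rooted R False t)) ts)"
      by (rule genfun_forest[OF dist]) (auto simp: rooted_def)
    ultimately show ?thesis
      using True by (simp add: IH cong: map_cong)
  qed
qed

lemma genfun_rtree:
  assumes "distinct (labels t)" "R \<subseteq> set (labels t)"
    "\<And>S. independent G S \<longleftrightarrow> S \<subseteq> set (labels t) \<and> indep S t"
  shows "genfun {S. independent G S \<and> R \<subseteq> S} = rgen R False t + rgen R True t"
proof -
  have "{S. independent G S \<and> R \<subseteq> S} = rooted R False t \<union> rooted R True t"
    using assms(2,3) by (auto simp: rooted_def)
  moreover have "rooted R False t \<inter> rooted R True t = {}"
    by (auto simp: rooted_def)
  ultimately show ?thesis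
    using assms(1) by (simp add: genfun_Un finite_rooted genfun_rooted)
qed

section \<open>Certificates on coefficient lists\<close>

text \<open>\<open>c\<close> carries the preceding coefficient, so that multiplying by 1 + x (or by
  1 + 2x in \<open>qmul_aux\<close>) is a single pass of additions.\<close>

primrec pmul_aux :: "nat \<Rightarrow> nat list \<Rightarrow> nat list" where
  "pmul_aux c [] = [c]"
| "pmul_aux c (x # xs) = (c + x) # pmul_aux x xs"

definition pmul :: "nat list \<Rightarrow> nat list" where
  "pmul xs = pmul_aux 0 xs"

text \<open>A separate constant, so that doubling a numeral can be rewritten to appending a binary
  digit instead of an addition.\<close>

definition double :: "nat \<Rightarrow> nat" where
  "double n = n + n"

primrec qmul_aux :: "nat \<Rightarrow> nat list \<Rightarrow> nat list" where
  "qmul_aux c [] = [double c]"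
| "qmul_aux c (x # xs) = (double c + x) # qmul_aux x xs"

definition qmul :: "nat list \<Rightarrow> nat list" where
  "qmul xs = qmul_aux 0 xs"

fun ladd :: "nat list \<Rightarrow> nat list \<Rightarrow> nat list" where
  "ladd [] ys = ys"
| "ladd (x # xs) [] = x # xs"
| "ladd (x # xs) (y # ys) = (x + y) # ladd xs ys"

text \<open>The default 0 is the coefficient beyond the end of a list; together with
  \<open>tl [] = []\<close> it makes reading past the end harmless.\<close>

primrec head :: "nat list \<Rightarrow> nat" where
  "head [] = 0"
| "head (x # xs) = x"

text \<open>
  \<open>rises\<close> and \<open>descends\<close> test whether the difference of two coefficient sequences rises up to
  some index and descends from there on. The terms are moved across the inequality signs so that
  nothing is ever subtracted. The branching goes through a Boolean argument of \<open>rises_step\<close>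
  because the simplifier would otherwise evaluate both branches of a conditional.
\<close>

fun descends :: "nat \<Rightarrow> nat \<Rightarrow> nat list \<Rightarrow> nat list \<Rightarrow> bool" where
  "descends a f [] fs = True"
| "descends a f (a' # as) [] = (a' + f \<le> a \<and> descends a' 0 as [])"
| "descends a f (a' # as) (f' # fs) = (a' + f \<le> a + f' \<and> descends a' f' as fs)"

fun rises :: "nat \<Rightarrow> nat \<Rightarrow> nat list \<Rightarrow> nat list \<Rightarrow> bool"
  and rises_step :: "bool \<Rightarrow> nat \<Rightarrow> nat \<Rightarrow> nat list \<Rightarrow> nat list \<Rightarrow> bool" where
  "rises a f [] fs = True"
| "rises a f (a' # as) [] = rises_step (a \<le> a' + f) a' 0 as []"
| "rises a f (a' # as) (f' # fs) = rises_step (a + f' \<le> a' + f) a' f' as fs"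
| "rises_step True a f as fs = rises a f as fs"
| "rises_step False a f as fs = descends a f as fs"

text \<open>
  With \<open>c = a - f\<close> this is \<open>c'^2 < c * c''\<close>, expanded so that no subtraction occurs.
  After dropping \<open>k\<close> coefficients the violated inequality is the one centred at \<open>k + 1\<close>.
\<close>

definition lc_fails :: "nat list \<Rightarrow> nat list \<Rightarrow> bool" where
  "lc_fails as fs \<longleftrightarrow>
    (let a = head as; a' = head (tl as); a'' = head (tl (tl as));
         f = head fs; f' = head (tl fs); f'' = head (tl (tl fs))
     in a' * a' + f' * f' + a * f'' + f * a'' < a * a'' + f * f'' + double (a' * f'))"

primrec lc_fails_at :: "nat list \<Rightarrow> nat list \<Rightarrow> nat list \<Rightarrow> bool" where
  "lc_fails_at [] as fs \<longleftrightarrow> False"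
| "lc_fails_at (k # ks) as fs \<longleftrightarrow> lc_fails ((tl ^^ k) as) ((tl ^^ k) fs) \<or> lc_fails_at ks as fs"

definition check :: "nat list \<Rightarrow> nat list \<Rightarrow> nat list \<Rightarrow> bool" where
  "check js as fs \<longleftrightarrow> rises 0 0 as fs \<and> lc_fails_at js as fs"

text \<open>
  The possible restrictions of a pair of required vertices to one branch of Galvin's tree: the
  child itself (\<open>RC\<close>), an inner (\<open>RI\<close>) or outer (\<open>RO\<close>) vertex of an arm, or two nonadjacent
  ones. The pairs inner--inner and inner--outer on different arms behave alike (\<open>RII\<close>).
\<close>

datatype req = RC | RI | RO | RCO | RII | ROO

fun llin :: "req \<Rightarrow> nat list \<Rightarrow> nat list \<Rightarrow> nat list" where
  "llin RC g h = 0 # pmul (pmul h)"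
| "llin RI g h = 0 # qmul g"
| "llin RO g h = 0 # ladd (qmul g) (0 # pmul h)"
| "llin RCO g h = 0 # 0 # pmul h"
| "llin RII g h = 0 # 0 # g"
| "llin ROO g h = 0 # 0 # ladd g (0 # h)"

primrec check1 :: "nat list \<Rightarrow> nat list \<Rightarrow> req list \<Rightarrow> nat list \<Rightarrow> nat list \<Rightarrow> bool" where
  "check1 js as [] g h = True"
| "check1 js as (\<tau> # \<tau>s) g h = (check js as (llin \<tau> g h) \<and> check1 js as \<tau>s g h)"

text \<open>\<open>g\<close>, \<open>h\<close> and \<open>k\<close> are what surrounds two branches
  when none, exactly one, or both of their children are selected. The mixed case has a single entry
  because the rest of the tree treats the two branches alike.\<close>

primrec check2 :: "nat list \<Rightarrow> nat list \<Rightarrow> req list \<Rightarrow> req list \<Rightarrow>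
    nat list \<Rightarrow> nat list \<Rightarrow> nat list \<Rightarrow> bool" where
  "check2 js as \<sigma>s [] g h k = True"
| "check2 js as \<sigma>s (\<tau> # \<tau>s) g h k =
    (check1 js as \<sigma>s (llin \<tau> g h) (llin \<tau> h k) \<and> check2 js as \<sigma>s \<tau>s g h k)"

definition qpow :: "nat \<Rightarrow> nat list \<Rightarrow> nat list" where "qpow n xs = (qmul ^^ n) xs"
definition ppow :: "nat \<Rightarrow> nat list \<Rightarrow> nat list" where "ppow n xs = (pmul ^^ n) xs"
definition bmul :: "nat \<Rightarrow> nat list \<Rightarrow> nat list" where
  "bmul t xs = ladd (qpow (t + 2) xs) (0 # ppow (t + 2) xs)"

section \<open>The polynomials represented by the lists\<close>

definition P1 :: "nat poly" where "P1 = 1 + X"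

definition P2 :: "nat poly" where "P2 = 1 + 2 * X"

text \<open>Coefficients shall stay in the form \<open>coeff (Poly xs)\<close>, which follows the
  recursion on lists through \<open>pCons\<close>, and not turn into
  \<open>nth_default\<close>.\<close>

declare coeff_Poly_eq [simp del]

lemma X_times: "X * p = pCons 0 p"
  by (rule poly_eqI) (auto simp: X_def coeff_monom_mult coeff_pCons split: nat.split)

lemma P1_times: "P1 * p = p + pCons 0 p"
  by (simp add: P1_def distrib_right X_times)

lemma P2_times: "P2 * p = p + pCons 0 (p + p)"
  by (simp add: P2_def distrib_right mult_2 X_times)

lemma Poly_shift: "Poly (0 # xs) = X * Poly xs"
  by (simp add: X_times)

lemma Poly_pmul: "Poly (pmul xs) = P1 * Poly xs"
proof -
  have "Poly (pmul_aux c xs) = [:c:] + P1 * Poly xs" for c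
    by (induction xs arbitrary: c) (simp_all add: P1_times ac_simps del: mult_pCons_right)
  then show ?thesis
    by (simp add: pmul_def)
qed

lemma Poly_qmul: "Poly (qmul xs) = P2 * Poly xs"
proof -
  have "Poly (qmul_aux c xs) = [:double c:] + P2 * Poly xs" for c
    by (induction xs arbitrary: c) (simp_all add: P2_times double_def ac_simps del: mult_pCons_right)
  then show ?thesis
    by (simp add: qmul_def double_def)
qed

lemma Poly_ladd: "Poly (ladd xs ys) = Poly xs + Poly ys"
  by (induction xs ys rule: ladd.induct) simp_all

lemma head_eq_coeff: "head xs = coeff (Poly xs) 0"
  by (cases xs) simp_all

lemma head_funpow_tl: "head ((tl ^^ i) xs) = coeff (Poly xs) i"
proof (induction i arbitrary: xs)
  case (Suc i)
  have "head ((tl ^^ Suc i) xs) = head ((tl ^^ i) (tl xs))"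
    by (simp add: funpow_swap1)
  also have "\<dots> = coeff (Poly xs) (Suc i)"
    by (subst Suc) (cases xs; simp)
  finally show ?case .
qed (simp add: head_eq_coeff)

section \<open>Soundness of the tests for unimodality and for failure of log-concavity\<close>

lemma descends_Cons:
  "descends a f (a' # as) fs \<longleftrightarrow> a' + f \<le> a + head fs \<and> descends a' (head fs) as (tl fs)"
  by (cases fs) simp_all

lemma rises_Cons:
  "rises a f (a' # as) fs \<longleftrightarrow>
    (if a + head fs \<le> a' + f then rises a' (head fs) as (tl fs) else descends a' (head fs) as (tl fs))"
  by (cases fs) simp_all

lemma descends_sound:
  assumes "descends a f as fs"
    and "\<And>i. c i + coeff (Poly (f # fs)) i = coeff (Poly (a # as)) i"
  shows "c (Suc i) \<le> c i"
  using assms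
proof (induction as arbitrary: a f fs c i)
  case Nil
  \<comment> \<open>With \<open>as\<close> exhausted the right-hand side of the equation is 0 at
    \<open>Suc i\<close>, which forces \<open>c (Suc i) = 0\<close> whatever is left of
    \<open>fs\<close>.\<close>
  from Nil.prems(2)[of "Suc i"] show ?case
    by simp
next
  case (Cons a' as)
  have c: "c (Suc i) + coeff (Poly (head fs # tl fs)) i = coeff (Poly (a' # as)) i" for i
    using Cons.prems(2)[of "Suc i"] by (cases fs) (auto simp: coeff_pCons split: nat.split)
  show ?case
  proof (cases i)
    case 0
    then show ?thesis
      using Cons.prems(1) Cons.prems(2)[of 0] c[of 0] by (simp add: descends_Cons)
  next
    case (Suc j)
    have "descends a' (head fs) as (tl fs)"
      using Cons.prems(1) by (simp add: descends_Cons)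
    from Cons.IH[OF this c, of j] show ?thesis
      using Suc by simp
  qed
qed

lemma rises_sound:
  assumes "rises a f as fs"
    and "\<And>i. c i + coeff (Poly (f # fs)) i = coeff (Poly (a # as)) i"
  shows "\<exists>m. (\<forall>i<m. c i \<le> c (Suc i)) \<and> (\<forall>i\<ge>m. c (Suc i) \<le> c i)"
  using assms
proof (induction as arbitrary: a f fs c)
  case Nil
  have "c (Suc i) \<le> c i" for i
    using Nil.prems(2)[of "Suc i"] by simp
  then show ?case
    by auto
next
  case (Cons a' as)
  have c: "c (Suc i) + coeff (Poly (head fs # tl fs)) i = coeff (Poly (a' # as)) i" for i
    using Cons.prems(2)[of "Suc i"] by (cases fs) (auto simp: coeff_pCons split: nat.split)
  have c0: "c 0 + f = a" "c 1 + head fs = a'"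
    using Cons.prems(2)[of 0] c[of 0] by simp_all
  show ?case
  proof (cases "a + head fs \<le> a' + f")
    case True
    then have "rises a' (head fs) as (tl fs)"
      using Cons.prems(1) by (simp add: rises_Cons)
    from Cons.IH[OF this c] obtain m where
      m: "\<And>i. i < m \<Longrightarrow> c (Suc i) \<le> c (Suc (Suc i))" "\<And>i. i \<ge> m \<Longrightarrow> c (Suc (Suc i)) \<le> c (Suc i)"
      by blast
    have "c i \<le> c (Suc i)" if "i < Suc m" for i
      using that True c0 m(1) by (cases i) auto
    moreover have "c (Suc i) \<le> c i" if "i \<ge> Suc m" for i
      using that m(2) by (cases i) auto
    ultimately show ?thesis
      by blast
  next
    case False
    then have "descends a' (head fs) as (tl fs)"
      using Cons.prems(1) by (simp add: rises_Cons)
    from descends_sound[OF this c] have "c (Suc (Suc i)) \<le> c (Suc i)" for i .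
    then have "c (Suc i) \<le> c i" for i
      using False c0 by (cases i) auto
    then show ?thesis
      by auto
  qed
qed

lemma unimodalI:
  assumes up: "\<And>i. i < m \<Longrightarrow> coeff p i \<le> coeff p (Suc i)"
    and down: "\<And>i. i \<ge> m \<Longrightarrow> coeff p (Suc i) \<le> coeff p i"
  shows "unimodal p"
proof (cases "m \<le> degree p")
  case True
  then show ?thesis
    using assms by (auto simp: unimodal_def)
next
  case False
  \<comment> \<open>Rising beyond the degree bounds the leading coefficient by 0, so
    \<open>p\<close> is the zero polynomial.\<close>
  then have "lead_coeff p = 0"
    using up[of "degree p"] by (simp add: coeff_eq_0)
  then show ?thesis
    by (simp add: unimodal_def)
qed

lemma rises_unimodal:
  assumes "rises 0 0 as fs" "I + Poly fs = Poly as"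
  shows "unimodal I"
proof -
  have "coeff I i + coeff (Poly fs) i = coeff (Poly as) i" for i
    by (simp add: assms(2) flip: coeff_add)
  \<comment> \<open>\<open>rises\<close> compares each entry with a preceding one; the prepended
    zero serves as predecessor of the constant term. It shifts the peak by one, hence
    \<open>m - 1\<close> below.\<close>
  then have "coeff (pCons 0 I) i + coeff (Poly (0 # fs)) i = coeff (Poly (0 # as)) i" for i
    by (cases i) simp_all
  from rises_sound[OF assms(1) this] obtain m where
    m: "\<And>i. i < m \<Longrightarrow> coeff (pCons 0 I) i \<le> coeff (pCons 0 I) (Suc i)"
      "\<And>i. i \<ge> m \<Longrightarrow> coeff (pCons 0 I) (Suc i) \<le> coeff (pCons 0 I) i"
    by blast
  show ?thesis
  proof (rule unimodalI[of "m - 1"])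
    show "coeff I i \<le> coeff I (Suc i)" if "i < m - 1" for i
      using m(1)[of "Suc i"] that by simp
    show "coeff I (Suc i) \<le> coeff I i" if "m - 1 \<le> i" for i
      using m(2)[of "Suc i"] that by simp
  qed
qed

lemma lc_fails_sound:
  assumes "lc_fails ((tl ^^ i) as) ((tl ^^ i) fs)" "I + Poly fs = Poly as"
  shows "\<not> log_concave I"
proof -
  define c f where "c = coeff I" and "f = coeff (Poly fs)"
  have as: "head ((tl ^^ j) as) = c j + f j" for j
    by (simp add: head_funpow_tl c_def f_def flip: assms(2))
  have "lc_fails ((tl ^^ i) as) ((tl ^^ i) fs) \<longleftrightarrow>
      (c (i+1) + f (i+1)) * (c (i+1) + f (i+1)) + f (i+1) * f (i+1)
        + (c i + f i) * f (i+2) + f i * (c (i+2) + f (i+2))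
      < (c i + f i) * (c (i+2) + f (i+2)) + f i * f (i+2) + double ((c (i+1) + f (i+1)) * f (i+1))"
    using as[of i] as[of "i+1"] as[of "i+2"]
      head_funpow_tl[of i fs] head_funpow_tl[of "i+1" fs] head_funpow_tl[of "i+2" fs]
    by (simp add: lc_fails_def Let_def f_def)
  then have "(c (i+1))\<^sup>2 < c i * c (i+2)"
    using assms(1) by (simp add: double_def power2_eq_square algebra_simps)
  \<comment> \<open>\<open>log_concave\<close> speaks only of indices below the degree. The strict
    inequality itself shows that the centre \<open>i + 1\<close> is one of them.\<close>
  moreover from this have "coeff I (i + 2) \<noteq> 0"
    by (intro notI) (simp add: c_def)
  then have "i + 1 < degree I"
    using le_degree[of I "i + 2"] by simp
  ultimately show ?thesis
    by (auto simp: log_concave_def c_def not_le intro!: exI[of _ "i+1"])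
qed

text \<open>Stands for "A - F is unimodal and not log-concave" without subtracting.\<close>

definition good :: "nat poly \<Rightarrow> nat poly \<Rightarrow> bool" where
  "good A F \<longleftrightarrow> (\<forall>I. I + F = A \<longrightarrow> unimodal I \<and> \<not> log_concave I)"

lemma check_sound:
  assumes "check js as fs"
  shows "good (Poly as) (Poly fs)"
proof -
  have "\<exists>k. lc_fails ((tl ^^ k) as) ((tl ^^ k) fs)" if "lc_fails_at js as fs"
    using that by (induction js) auto
  then show ?thesis
    using assms unfolding check_def good_def by (blast intro: rises_unimodal dest: lc_fails_sound)
qed

text \<open>
  Up to the common factors \<open>P2 ^ t\<close> and \<open>P1 ^ t\<close>, which are absorbed into \<open>g\<close> and \<open>h\<close>, a branch with
  \<open>t + 2\<close> arms has generating function \<open>lin \<tau> g 0\<close> or \<open>lin \<tau> 0 h\<close> when its child is excluded or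
  included, respectively.
\<close>

fun lin :: "req \<Rightarrow> nat poly \<Rightarrow> nat poly \<Rightarrow> nat poly" where
  "lin RC g h = X * P1 ^ 2 * h"
| "lin RI g h = X * P2 * g"
| "lin RO g h = X * (P2 * g + X * P1 * h)"
| "lin RCO g h = X ^ 2 * P1 * h"
| "lin RII g h = X ^ 2 * g"
| "lin ROO g h = X ^ 2 * (g + X * h)"

lemma Poly_llin: "Poly (llin \<tau> g h) = lin \<tau> (Poly g) (Poly h)"
  by (cases \<tau>) (simp_all add: Poly_shift Poly_pmul Poly_qmul Poly_ladd power2_eq_square
      algebra_simps del: Poly.simps)

lemma check1_sound:
  "check1 js as \<tau>s g h \<Longrightarrow> \<tau> \<in> set \<tau>s \<Longrightarrow> good (Poly as) (lin \<tau> (Poly g) (Poly h))"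
  by (induction \<tau>s) (auto dest: check_sound simp: Poly_llin)

lemma check2_sound:
  "check2 js as \<sigma>s \<tau>s g h k \<Longrightarrow> \<sigma> \<in> set \<sigma>s \<Longrightarrow> \<tau> \<in> set \<tau>s \<Longrightarrow>
    good (Poly as) (lin \<sigma> (lin \<tau> (Poly g) (Poly h)) (lin \<tau> (Poly h) (Poly k)))"
  by (induction \<tau>s) (auto dest: check1_sound simp: Poly_llin)

lemma Poly_qpow: "Poly (qpow n xs) = P2 ^ n * Poly xs"
  by (induction n) (simp_all add: qpow_def Poly_qmul algebra_simps)

lemma Poly_ppow: "Poly (ppow n xs) = P1 ^ n * Poly xs"
  by (induction n) (simp_all add: ppow_def Poly_pmul algebra_simps)

text \<open>\<open>B t\<close> belongs to a branch with \<open>t + 2\<close> arms whose parent is not selected.\<close>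

definition B :: "nat \<Rightarrow> nat poly" where
  "B t = P2 ^ (t + 2) + X * P1 ^ (t + 2)"

lemma Poly_bmul: "Poly (bmul t xs) = B t * Poly xs"
  by (simp add: bmul_def B_def Poly_ladd Poly_qpow Poly_ppow Poly_shift algebra_simps del: Poly.simps)

text \<open>\<open>x\<close> and \<open>y\<close> are the contributions of the rest with the parent
  of the branch unselected and selected. A selected child allows only \<open>x\<close>, an
  unselected one allows both.\<close>

lemma lin_sum: "lin \<tau> (a * (x + y)) (b * x) = lin \<tau> a b * x + lin \<tau> a 0 * y"
  by (cases \<tau>) (simp_all add: algebra_simps)

text \<open>
  The generating functions of two branches enter bilinearly; \<open>x\<close>, \<open>y\<close> and \<open>z\<close> are what the rest of
  the tree contributes. Grouping by powers of \<open>a\<close> and \<open>b\<close> leaves three polynomials that do not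
  depend on \<open>\<sigma>\<close> and \<open>\<tau>\<close>.
\<close>

lemma lin_lin_sum:
  "lin \<sigma> (lin \<tau> (a * (a * (x + y + (y + z)))) (b * (a * (x + y)))) (lin \<tau> (b * (a * (x + y))) (b * (b * x)))
    = lin \<tau> a b * lin \<sigma> a b * x + (lin \<tau> a b * lin \<sigma> a 0 + lin \<tau> a 0 * lin \<sigma> a b) * y
      + lin \<tau> a 0 * lin \<sigma> a 0 * z"
  by (cases \<tau>; cases \<sigma>) (simp_all add: algebra_simps power2_eq_square)

text \<open>The case of two branches at the same root: it cannot be selected for one branch and
  unselected for the other, so the mixed contribution \<open>y\<close> is 0.\<close>

lemma lin_lin_sum':
  "lin \<sigma> (lin \<tau> (a * (a * (x + z))) (b * (a * x))) (lin \<tau> (b * (a * x)) (b * (b * x)))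
    = lin \<tau> a b * lin \<sigma> a b * x + lin \<tau> a 0 * lin \<sigma> a 0 * z"
  using lin_lin_sum[of \<sigma> \<tau> a x 0 z b] by simp

section \<open>Checks that cover all nonedges of a tree\<close>

abbreviation (input) singles :: "req list" where "singles \<equiv> [RC, RI, RO]"
abbreviation (input) doubles :: "req list" where "doubles \<equiv> [RCO, RII, ROO]"

text \<open>
  The \<open>_aux\<close> definitions below serve evaluation by rewriting: the simplifier normalizes the
  arguments of such a constant before it unfolds it, so that shared lists are computed only once.
\<close>

definition pair_check_aux where
  "pair_check_aux t js a x y \<longleftrightarrow>
     check1 js a doubles (qpow t (ladd (bmul t x) (qpow (t + 2) y))) (ppow t (bmul t x)) \<and>
     check2 js a singles singles
       (qpow t (qpow t (ladd x y))) (ppow t (qpow t x)) (ppow t (ppow t x)) \<and>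
     check js a (0 # qmul (qpow t (qpow (t + 2) y)))"

text \<open>\<open>u\<close> and \<open>v\<close> weigh the sets without and with the root of one
  Galvin tree by what lies outside of it. The conjuncts of \<open>pair_check_aux\<close> treat two
  vertices in one branch, two vertices in different branches, and nonedges at the root.\<close>

definition pair_check where
  "pair_check m t js a u v =
     pair_check_aux t js a ((bmul t ^^ m) u) (0 # (qpow (t + 2) ^^ m) v)"

text \<open>The tree has \<open>m + 2\<close> branches of \<open>t + 2\<close> arms. Two vertices
  touch at most two branches, and at most two arms of each, so \<open>m\<close> and \<open>t\<close>
  are the exponents of the factors that surely remain.\<close>

definition galvin_check where
  "galvin_check m t js =
     pair_check m t js
       (ladd ((bmul t ^^ (m + 2)) [1]) (0 # (qpow (t + 2) ^^ (m + 2)) [1])) [1] [1]"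

definition single_check_aux where
  "single_check_aux t js a x y = check1 js a singles (qpow t (ladd x y)) (ppow t x)"

definition single_check where
  "single_check t js a u v =
     single_check_aux t js a ((bmul t ^^ 2) u) (0 # (qpow (t + 2) ^^ 2) v)"

definition copies_check where
  "copies_check t js a x y z \<longleftrightarrow>
     check2 js a singles singles
       (qpow t (qpow t (ladd (ladd x y) (ladd y z)))) (ppow t (qpow t (ladd x y))) (ppow t (ppow t x))"

definition dmul where
  "dmul t xs = ladd ((bmul t ^^ 3) xs) (0 # (qpow (t + 2) ^^ 3) xs)"

text \<open>Nonedges away from the pendant leaf: inside a copy; between nonroot vertices of two
  copies; between a root and a nonroot vertex; between two roots; at the apex. \<open>e\<close> and
  \<open>d\<close> carry the factor \<open>P1\<close> of the free leaf, while \<open>c\<close> and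
  \<open>c'\<close> belong to a selected apex, which excludes the leaf.\<close>

definition bautista_ramos_check_aux2 where
  "bautista_ramos_check_aux2 t js e c d c' a \<longleftrightarrow>
     pair_check 1 t js a (ladd d (0 # c')) d \<and>
     copies_check t js a ((bmul t ^^ 4) (ladd e (0 # c)))
       (0 # (bmul t ^^ 2) ((qpow (t + 2) ^^ 2) e)) (0 # 0 # (qpow (t + 2) ^^ 4) e) \<and>
     single_check t js a (0 # (qpow (t + 2) ^^ 3) e) (0 # (qpow (t + 2) ^^ 3) e) \<and>
     check js a (0 # 0 # (qpow (t + 2) ^^ 6) e) \<and>
     single_check t js a (0 # c') []"

text \<open>The last two conjuncts treat nonedges at the pendant leaf. It is then selected and the
  apex is not, so the factor \<open>P1\<close> is replaced by \<open>X\<close> and \<open>d\<close>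
  enters before \<open>pmul\<close>.\<close>

definition bautista_ramos_check_aux1 where
  "bautista_ramos_check_aux1 t js e c d c' a \<longleftrightarrow>
     bautista_ramos_check_aux2 t js (pmul e) c (pmul d) c' a \<and>
     single_check t js a (0 # d) (0 # d) \<and>
     check js a (0 # 0 # (qpow (t + 2) ^^ 3) d)"

definition bautista_ramos_check_aux where
  "bautista_ramos_check_aux t js e c d c' =
     bautista_ramos_check_aux1 t js e c d c' (ladd (pmul (dmul t d)) (0 # (bmul t ^^ 3) c'))"

definition bautista_ramos_check where
  "bautista_ramos_check m t js =
     bautista_ramos_check_aux t js ((dmul t ^^ m) [1]) ((bmul t ^^ (3 * m)) [1])
       ((dmul t ^^ (m + 1)) [1]) ((bmul t ^^ (3 * m + 3)) [1])"

text \<open>The independence polynomial of one copy, \<open>galvin_tree 3 (t + 2)\<close>, split at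
  its root.\<close>

definition D :: "nat \<Rightarrow> nat poly" where
  "D t = B t ^ 3 + X * (P2 ^ (t + 2)) ^ 3"

section \<open>Soundness of the checks for whole trees\<close>

lemma Poly_funpow:
  assumes "\<And>xs. Poly (f xs) = p * Poly xs"
  shows "Poly ((f ^^ n) xs) = p ^ n * Poly xs"
  by (induction n) (simp_all add: assms mult.assoc)

lemmas Poly_simps = Poly_shift Poly_pmul Poly_qmul Poly_ladd Poly_qpow Poly_ppow Poly_bmul
  Poly_funpow[of "bmul _", OF Poly_bmul] Poly_funpow[of "qpow _", OF Poly_qpow]

lemma Poly_one: "Poly [1] = 1"
  by simp

lemma Poly_dmul: "Poly (dmul t xs) = D t * Poly xs"
  by (simp only: dmul_def D_def Poly_simps distrib_right mult.assoc)

text \<open>The factor of a branch when its parent is unselected, so that the child is free, and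
  when its parent is selected, so that the child is out.\<close>

abbreviation (input) bsum :: "nat \<Rightarrow> req \<Rightarrow> nat poly" where "bsum t \<tau> \<equiv> lin \<tau> (P2 ^ t) (P1 ^ t)"
abbreviation (input) bout :: "nat \<Rightarrow> req \<Rightarrow> nat poly" where "bout t \<tau> \<equiv> lin \<tau> (P2 ^ t) 0"

lemma pair_check_sound:
  assumes "pair_check m t js a u v"
  shows "\<tau> \<in> set doubles \<Longrightarrow> good (Poly a)
      (bsum t \<tau> * B t ^ (m + 1) * Poly u + X * (bout t \<tau> * (P2 ^ (t + 2)) ^ (m + 1)) * Poly v)"
    and "\<sigma> \<in> set singles \<Longrightarrow> \<tau> \<in> set singles \<Longrightarrow> good (Poly a)
      (bsum t \<tau> * bsum t \<sigma> * B t ^ m * Poly u + X * (bout t \<tau> * bout t \<sigma> * (P2 ^ (t + 2)) ^ m) * Poly v)"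
    and "good (Poly a) (X * (X * P2 * P2 ^ t * (P2 ^ (t + 2)) ^ (m + 1)) * Poly v)"
proof -
  let ?q = "P2 ^ (t + 2)"
  define x y where "x = (bmul t ^^ m) u" and "y = 0 # (qpow (t + 2) ^^ m) v"
  have x: "Poly x = B t ^ m * Poly u" and y: "Poly y = X * (?q ^ m * Poly v)"
    by (simp_all only: x_def y_def Poly_simps)
  have "pair_check_aux t js a x y"
    using assms by (simp only: pair_check_def x_def y_def)
  then have c1: "check1 js a doubles (qpow t (ladd (bmul t x) (qpow (t + 2) y))) (ppow t (bmul t x))"
    and c2: "check2 js a singles singles
       (qpow t (qpow t (ladd x y))) (ppow t (qpow t x)) (ppow t (ppow t x))"
    and c3: "check js a (0 # qmul (qpow t (qpow (t + 2) y)))"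
    unfolding pair_check_aux_def by blast+
  show "good (Poly a) (bsum t \<tau> * B t ^ (m + 1) * Poly u + X * (bout t \<tau> * ?q ^ (m + 1)) * Poly v)"
    if "\<tau> \<in> set doubles"
    using check1_sound[OF c1 that] unfolding Poly_simps x y lin_sum by (simp add: mult_ac)
  show "good (Poly a) (bsum t \<tau> * bsum t \<sigma> * B t ^ m * Poly u + X * (bout t \<tau> * bout t \<sigma> * ?q ^ m) * Poly v)"
    if "\<sigma> \<in> set singles" "\<tau> \<in> set singles"
    using check2_sound[OF c2 that] unfolding Poly_simps x y lin_lin_sum' by (simp add: mult_ac)
  show "good (Poly a) (X * (X * P2 * P2 ^ t * ?q ^ (m + 1)) * Poly v)"
    using check_sound[OF c3] unfolding Poly_simps x y by (simp add: mult_ac)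
qed

lemma single_check_sound:
  assumes "single_check t js a u v" "\<tau> \<in> set singles"
  shows "good (Poly a) (bsum t \<tau> * B t ^ 2 * Poly u + X * (bout t \<tau> * (P2 ^ (t + 2)) ^ 2) * Poly v)"
  using check1_sound[OF assms(1)[unfolded single_check_def single_check_aux_def] assms(2)]
  unfolding Poly_simps lin_sum by (simp add: mult_ac)

section \<open>Evaluation on binary numerals\<close>

lemma double_simps: "double 0 = 0" "double (numeral n) = numeral (num.Bit0 n)"
  by (simp_all add: double_def numeral_Bit0)

text \<open>Iterations are unfolded along the binary digits of the exponent, which therefore never
  becomes a successor term.\<close>

lemma funpow_numeral_simps:
  "(f ^^ numeral num.One) x = f x"
  "(f ^^ numeral (num.Bit0 n)) x = (f ^^ numeral n) ((f ^^ numeral n) x)"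
  "(f ^^ numeral (num.Bit1 n)) x = (f ^^ numeral n) ((f ^^ numeral n) (f x))"
  by (simp, simp_all only: numeral.simps funpow_add o_apply funpow_simps_right funpow.simps id_apply One_nat_def)

text \<open>Reversing \<open>numeral_One\<close> turns 1 into a numeral, so that the numeral rules
  cover it; 0 is the one constant with arithmetic rules of its own.\<close>

lemmas eval_simps =
  galvin_check_def pair_check_def pair_check_aux_def single_check_def single_check_aux_def
  copies_check_def dmul_def bautista_ramos_check_def bautista_ramos_check_aux_def
  bautista_ramos_check_aux1_def bautista_ramos_check_aux2_def
  qpow_def ppow_def bmul_def
  check_def check1.simps check2.simps llin.simps lc_fails_at.simps lc_fails_def Let_def
  rises.simps rises_step.simps descends.simps head.simps list.sel
  ladd.simps pmul_def qmul_def pmul_aux.simps qmul_aux.simps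
  double_simps funpow_numeral_simps funpow.simps(1) id_apply numeral_One[symmetric]
  numeral_plus_numeral add_num_simps add_0_left add_0_right
  numeral_times_numeral mult_num_simps mult_zero_left mult_zero_right
  numeral_le_iff numeral_less_iff le_num_simps less_num_simps
  le0 not_numeral_le_zero not_numeral_less_zero zero_less_numeral simp_thms

text \<open>
  The pairs consist of the generating functions without and with the root of the independent sets
  of Galvin's tree (with \<open>m + 1\<close> or \<open>m + 2\<close> branches of \<open>t + 2\<close> arms) that contain a given vertex
  other than the root, or the ends of a given nonedge. The last double pair is for nonedges at the root.
\<close>

definition single_pairs :: "nat \<Rightarrow> nat \<Rightarrow> (nat poly \<times> nat poly) set" where
  "single_pairs m t =
     (\<lambda>\<tau>. (bsum t \<tau> * B t ^ m, X * (bout t \<tau> * (P2 ^ (t + 2)) ^ m))) ` set singles"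

definition double_pairs :: "nat \<Rightarrow> nat \<Rightarrow> (nat poly \<times> nat poly) set" where
  "double_pairs m t =
     (\<lambda>\<tau>. (bsum t \<tau> * B t ^ (m + 1), X * (bout t \<tau> * (P2 ^ (t + 2)) ^ (m + 1)))) ` set doubles \<union>
     (\<lambda>(\<tau>, \<sigma>). (bsum t \<tau> * bsum t \<sigma> * B t ^ m, X * (bout t \<tau> * bout t \<sigma> * (P2 ^ (t + 2)) ^ m)))
        ` (set singles \<times> set singles) \<union>
     {(0, X * (X * P2 * P2 ^ t * (P2 ^ (t + 2)) ^ (m + 1)))}"

lemma pair_check_double_pairs:
  "pair_check m t js a u v \<Longrightarrow> (p, r) \<in> double_pairs m t \<Longrightarrow> good (Poly a) (p * Poly u + r * Poly v)"
  using pair_check_sound[of m t js a u v]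
  by (auto simp only: double_pairs_def mult_zero_left add_0_left Un_iff image_iff Pair_inject
      split_beta fst_conv snd_conv mem_Times_iff singleton_iff)

lemma single_check_single_pairs:
  "single_check t js a u v \<Longrightarrow> (p, r) \<in> single_pairs 2 t \<Longrightarrow> good (Poly a) (p * Poly u + r * Poly v)"
  using single_check_sound[of t js a u v] by (auto simp only: single_pairs_def image_iff Pair_inject)

lemma galvin_check_sound:
  assumes "galvin_check m t js" "(p, r) \<in> double_pairs m t"
  shows "good (B t ^ (m + 2) + X * (P2 ^ (t + 2)) ^ (m + 2)) (p + r)"
  using pair_check_double_pairs[OF assms(1)[unfolded galvin_check_def] assms(2)]
  by (simp only: Poly_simps Poly_one mult_1_right)

text \<open>An unselected apex leaves the copies independent, each contributing the sum of its pair,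
  and the leaf gives \<open>P1\<close>; a selected apex allows only the first component of each
  pair. \<open>rt\<close> is the pair of a copy whose root is required.\<close>

lemma bautista_ramos_check_sound:
  assumes "bautista_ramos_check m t js"
  defines "A \<equiv> P1 * D t ^ (m + 2) + X * B t ^ (3 * m + 6)"
    and "rt \<equiv> (0, X * (P2 ^ (t + 2)) ^ 3)"
  shows "(p, r) \<in> double_pairs 1 t \<Longrightarrow>
      good A (P1 * ((p + r) * D t ^ (m + 1)) + X * (p * B t ^ (3 * m + 3)))"
    and "(p, r) \<in> insert rt (single_pairs 2 t) \<Longrightarrow> (p', r') \<in> insert rt (single_pairs 2 t) \<Longrightarrow>
      good A (P1 * ((p + r) * (p' + r') * D t ^ m) + X * (p * p' * B t ^ (3 * m)))"
    and "(p, r) \<in> single_pairs 2 t \<Longrightarrow> good A (X * (p * B t ^ (3 * m + 3)))"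
    and "(p, r) \<in> insert rt (single_pairs 2 t) \<Longrightarrow> good A (X * ((p + r) * D t ^ (m + 1)))"
proof -
  let ?q = "P2 ^ (t + 2)"
  define e c d c' where "e = (dmul t ^^ m) [1]" and "c = (bmul t ^^ (3 * m)) [1]"
    and "d = (dmul t ^^ (m + 1)) [1]" and "c' = (bmul t ^^ (3 * m + 3)) [1]"
  define a where "a = ladd (pmul (dmul t d)) (0 # (bmul t ^^ 3) c')"
  note Poly_simps' = Poly_simps Poly_dmul Poly_funpow[of "dmul _", OF Poly_dmul] Poly_one mult_1_right
  have e: "Poly e = D t ^ m" and c: "Poly c = B t ^ (3 * m)"
    and d: "Poly d = D t ^ (m + 1)" and c': "Poly c' = B t ^ (3 * m + 3)"
    by (simp_all only: e_def c_def d_def c'_def Poly_simps')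
  have a: "Poly a = A"
    unfolding a_def Poly_simps' d c' A_def by (simp add: power_add eval_nat_numeral mult_ac)
  have "bautista_ramos_check_aux1 t js e c d c' a"
    using assms(1) unfolding bautista_ramos_check_def bautista_ramos_check_aux_def
    by (simp only: e_def c_def d_def c'_def a_def)
  then have pair: "pair_check 1 t js a (ladd (pmul d) (0 # c')) (pmul d)"
    and copies: "copies_check t js a ((bmul t ^^ 4) (ladd (pmul e) (0 # c)))
       (0 # (bmul t ^^ 2) ((qpow (t + 2) ^^ 2) (pmul e))) (0 # 0 # (qpow (t + 2) ^^ 4) (pmul e))"
    and root1: "single_check t js a (0 # (qpow (t + 2) ^^ 3) (pmul e)) (0 # (qpow (t + 2) ^^ 3) (pmul e))"
    and root2: "check js a (0 # 0 # (qpow (t + 2) ^^ 6) (pmul e))"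
    and apex: "single_check t js a (0 # c') []"
    and pendant: "single_check t js a (0 # d) (0 # d)"
    and pendant_root: "check js a (0 # 0 # (qpow (t + 2) ^^ 3) d)"
    unfolding bautista_ramos_check_aux1_def bautista_ramos_check_aux2_def by blast+
  note Ps = Poly_simps' Poly.simps(1) e c d c' a
  show "good A (P1 * ((p + r) * D t ^ (m + 1)) + X * (p * B t ^ (3 * m + 3)))"
    if "(p, r) \<in> double_pairs 1 t"
    using pair_check_double_pairs[OF pair that] unfolding Ps by (simp only: algebra_simps)
  show "good A (X * (p * B t ^ (3 * m + 3)))" if "(p, r) \<in> single_pairs 2 t"
    using single_check_single_pairs[OF apex that] unfolding Ps by (simp add: mult_ac)
  show "good A (X * ((p + r) * D t ^ (m + 1)))" if "(p, r) \<in> insert rt (single_pairs 2 t)"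
  proof (cases "(p, r) \<in> single_pairs 2 t")
    case True
    show ?thesis
      using single_check_single_pairs[OF pendant True] unfolding Ps by (simp only: algebra_simps)
  next
    case False
    then have "p = 0" "r = X * ?q ^ 3"
      using that by (auto simp: rt_def)
    then show ?thesis
      using check_sound[OF pendant_root] unfolding Ps by (simp only: algebra_simps add_0_left)
  qed
  have root: "good A (P1 * ((0 + X * ?q ^ 3) * (p + r) * D t ^ m) + X * (0 * p * B t ^ (3 * m)))"
    if "(p, r) \<in> insert rt (single_pairs 2 t)" for p r
  proof (cases "(p, r) \<in> single_pairs 2 t")
    case True
    show ?thesis
      using single_check_single_pairs[OF root1 True] unfolding Ps
      by (simp only: algebra_simps mult_zero_left mult_zero_right add_0_left add_0_right)
  next
    case False
    then have "p = 0" "r = X * ?q ^ 3"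
      using that by (auto simp: rt_def)
    moreover have "?q ^ 6 = ?q ^ 3 * ?q ^ 3"
      by (simp flip: power_add)
    ultimately show ?thesis
      using check_sound[OF root2] unfolding Ps
      by (simp only: algebra_simps mult_zero_left mult_zero_right add_0_left add_0_right)
  qed
  show "good A (P1 * ((p + r) * (p' + r') * D t ^ m) + X * (p * p' * B t ^ (3 * m)))"
    if "(p, r) \<in> insert rt (single_pairs 2 t)" "(p', r') \<in> insert rt (single_pairs 2 t)"
  proof (cases "(p, r) = rt \<or> (p', r') = rt")
    case True
    then show ?thesis
      using root[OF that(1)] root[OF that(2)] by (auto simp: rt_def ac_simps)
  next
    case False
    then have "(p, r) \<in> single_pairs 2 t" "(p', r') \<in> single_pairs 2 t"
      using that by auto
    then obtain \<tau> \<sigma> where ts: "\<tau> \<in> set singles" "\<sigma> \<in> set singles"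
      and "(p, r) = (bsum t \<tau> * B t ^ 2, X * (bout t \<tau> * ?q ^ 2))"
        "(p', r') = (bsum t \<sigma> * B t ^ 2, X * (bout t \<sigma> * ?q ^ 2))"
      unfolding single_pairs_def by (elim imageE)
    then have pr: "p = bsum t \<tau> * B t ^ 2" "r = X * (bout t \<tau> * ?q ^ 2)"
        "p' = bsum t \<sigma> * B t ^ 2" "r' = X * (bout t \<sigma> * ?q ^ 2)"
      unfolding Pair_inject by blast+
    have pow: "B t ^ 4 = B t ^ 2 * B t ^ 2" "?q ^ 4 = ?q ^ 2 * ?q ^ 2"
      by (simp_all flip: power_add)
    show ?thesis
      using check2_sound[OF copies[unfolded copies_check_def] ts(2,1)]
      unfolding Ps lin_lin_sum pr pow by (simp only: algebra_simps)
  qed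
qed

section \<open>Galvin's trees\<close>

definition arm :: "nat \<Rightarrow> nat \<Rightarrow> vertex rtree" where
  "arm i j = Node (Inner i j) [Node (Outer i j) []]"

definition branch :: "nat \<Rightarrow> nat \<Rightarrow> vertex rtree" where
  "branch t i = Node (Child i) (map (arm i) [0..<t])"

definition galvin_rtree :: "nat \<Rightarrow> nat \<Rightarrow> vertex rtree" where
  "galvin_rtree m t = Node Root (map (branch t) [0..<m])"

lemma distinct_concat_map:
  assumes "distinct xs" "\<And>x. x \<in> set xs \<Longrightarrow> distinct (f x)"
    "\<And>x y. x \<in> set xs \<Longrightarrow> y \<in> set xs \<Longrightarrow> x \<noteq> y \<Longrightarrow> set (f x) \<inter> set (f y) = {}"
  shows "distinct (concat (map f xs))"
  using assms
proof (induction xs)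
  case (Cons a xs)
  have "distinct (concat (map f xs))"
    using Cons by auto
  moreover have "set (f a) \<inter> (\<Union>x\<in>set xs. set (f x)) = {}"
    using Cons.prems(1,3) by fastforce
  ultimately show ?case
    using Cons.prems(2) by simp
qed simp

lemma set_labels_branch:
  "set (labels (branch t i)) = {Child i} \<union> {Inner i j | j. j < t} \<union> {Outer i j | j. j < t}"
  by (auto simp: branch_def arm_def)

lemma set_labels_galvin_rtree: "set (labels (galvin_rtree m t)) = verts (galvin_tree m t)"
  by (auto simp: galvin_rtree_def set_labels_branch galvin_tree_def)

lemma distinct_labels_galvin_rtree: "distinct (labels (galvin_rtree m t))"
proof -
  have "distinct (labels (branch t i))" for i
    unfolding branch_def labels.simps map_map distinct.simps
    by (intro conjI distinct_concat_map) (auto simp: arm_def)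
  then show ?thesis
    unfolding galvin_rtree_def labels.simps map_map distinct.simps
    by (intro conjI distinct_concat_map) (auto simp: set_labels_branch)
qed

lemma independent_iff:
  assumes "finite_simple_graph G"
  shows "independent G S \<longleftrightarrow> S \<subseteq> verts G \<and> (\<forall>e\<in>edges G. \<not> e \<subseteq> S)"
proof -
  have "\<exists>u\<in>S. \<exists>v\<in>S. {u, v} \<in> edges G" if e: "e \<in> edges G" "e \<subseteq> S" for e
  proof -
    have "card e = 2"
      using assms e(1) by (simp add: finite_simple_graph_def)
    then obtain u v where "e = {u, v}"
      by (auto simp: card_2_iff)
    then show ?thesis
      using e by auto
  qed
  moreover have "{u, v} \<subseteq> S" if "u \<in> S" "v \<in> S" for u v
    using that by simp
  ultimately show ?thesis
    unfolding independent_def by metis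
qed

lemma indep_galvin_rtree:
  "indep S (galvin_rtree m t) \<longleftrightarrow> (\<forall>e\<in>edges (galvin_tree m t). \<not> e \<subseteq> S)"
proof -
  have *: "(\<forall>e\<in>{f i j | i j. i < m \<and> j < t}. Q e) \<longleftrightarrow> (\<forall>i<m. \<forall>j<t. Q (f i j))"
    "(\<forall>e\<in>{g i | i. i < m}. Q e) \<longleftrightarrow> (\<forall>i<m. Q (g i))" for f g and Q :: "vertex set \<Rightarrow> bool"
    by blast+
  show ?thesis
    unfolding galvin_tree_def snd_conv ball_Un *
    by (auto simp: galvin_rtree_def branch_def arm_def)
qed

section \<open>Generating functions with required vertices\<close>

lemma prod_list_upt: "prod_list (map f [0..<n]) = (\<Prod>i<n. f i)"
  by (induction n) (simp_all add: lessThan_Suc mult.commute)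

lemma prod_all_but_one:
  fixes f :: "nat \<Rightarrow> 'a::comm_monoid_mult"
  assumes "i < n + 1" "\<And>j. j < n + 1 \<Longrightarrow> j \<noteq> i \<Longrightarrow> f j = c"
  shows "(\<Prod>j<n + 1. f j) = f i * c ^ n"
proof -
  have "(\<Prod>j<n + 1. f j) = f i * (\<Prod>j\<in>{..<n + 1} - {i}. f j)"
    using assms(1) by (intro prod.remove) auto
  also have "(\<Prod>j\<in>{..<n + 1} - {i}. f j) = (\<Prod>j\<in>{..<n + 1} - {i}. c)"
    using assms(2) by (intro prod.cong) auto
  finally show ?thesis
    using assms(1) by simp
qed

lemma prod_all_but_two:
  fixes f :: "nat \<Rightarrow> 'a::comm_monoid_mult"
  assumes "i < n + 2" "i' < n + 2" "i \<noteq> i'"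
    "\<And>j. j < n + 2 \<Longrightarrow> j \<noteq> i \<Longrightarrow> j \<noteq> i' \<Longrightarrow> f j = c"
  shows "(\<Prod>j<n + 2. f j) = f i * f i' * c ^ n"
proof -
  have "(\<Prod>j<n + 2. f j) = f i * (\<Prod>j\<in>{..<n + 2} - {i}. f j)"
    using assms(1) by (intro prod.remove) auto
  also have "(\<Prod>j\<in>{..<n + 2} - {i}. f j) = f i' * (\<Prod>j\<in>{..<n + 2} - {i} - {i'}. f j)"
    using assms(2,3) by (intro prod.remove) auto
  also have "(\<Prod>j\<in>{..<n + 2} - {i} - {i'}. f j) = (\<Prod>j\<in>{..<n + 2} - {i} - {i'}. c)"
    using assms(4) by (intro prod.cong) auto
  finally show ?thesis
    using assms(1-3) by (simp add: mult.assoc)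
qed

lemma rgen_arm:
  "rgen R True (arm i j) = (if Outer i j \<in> R then 0 else X)"
  "rgen R False (arm i j) =
     (if Inner i j \<in> R then 0 else if Outer i j \<in> R then X else P1)"
  by (simp_all add: arm_def P1_def)

text \<open>Under an unselected child a free arm is an edge, with polynomial 1 + 2x; under a
  selected child only its outer vertex is available, which gives 1 + x.\<close>

lemma rgen_branch:
  "rgen R False (branch t i) = (if Child i \<in> R then 0 else
     \<Prod>j<t. if Inner i j \<in> R then if Outer i j \<in> R then 0 else X
       else if Outer i j \<in> R then X else P2)"
  "rgen R True (branch t i) = X *
     (\<Prod>j<t. if Inner i j \<in> R then 0 else if Outer i j \<in> R then X else P1)"
proof -
  have "P1 + X = P2"
    by (simp add: P1_def P2_def mult_2 add.assoc)
  then show "rgen R False (branch t i) = (if Child i \<in> R then 0 else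
     \<Prod>j<t. if Inner i j \<in> R then if Outer i j \<in> R then 0 else X
       else if Outer i j \<in> R then X else P2)"
    by (auto simp: branch_def rgen_arm prod_list_upt comp_def intro!: prod.cong)
qed (auto simp: branch_def rgen_arm prod_list_upt comp_def)

lemma rgen_galvin_rtree:
  "rgen R False (galvin_rtree m t) = (if Root \<in> R then 0 else
     \<Prod>i<m. rgen R False (branch t i) + rgen R True (branch t i))"
  "rgen R True (galvin_rtree m t) = X * (\<Prod>i<m. rgen R False (branch t i))"
  by (simp_all add: galvin_rtree_def prod_list_upt comp_def)

lemma rgen_branch_free:
  assumes "R \<inter> set (labels (branch t i)) = {}"
  shows "rgen R False (branch t i) = P2 ^ t" "rgen R True (branch t i) = X * P1 ^ t"
proof -
  have "Child i \<notin> R" and "\<And>j. j < t \<Longrightarrow> Inner i j \<notin> R \<and> Outer i j \<notin> R"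
    using assms by (auto simp: set_labels_branch)
  then show "rgen R False (branch t i) = P2 ^ t" "rgen R True (branch t i) = X * P1 ^ t"
    by (simp_all add: rgen_branch)
qed

definition branch_type :: "vertex set \<Rightarrow> nat \<Rightarrow> nat \<Rightarrow> req \<Rightarrow> bool" where
  "branch_type R t i \<tau> \<longleftrightarrow> rgen R False (branch (t + 2) i) = lin \<tau> (P2 ^ t) 0 \<and>
     rgen R True (branch (t + 2) i) = lin \<tau> 0 (P1 ^ t)"

lemma branch_type_cong:
  assumes "R \<inter> set (labels (branch (t + 2) i)) = R' \<inter> set (labels (branch (t + 2) i))"
  shows "branch_type R t i \<tau> = branch_type R' t i \<tau>"
proof -
  have "rgen R b (branch (t + 2) i) = rgen R' b (branch (t + 2) i)" for b
    using assms by (intro rgen_cong) blast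
  then show ?thesis
    by (simp add: branch_type_def)
qed

lemma branch_type_sum:
  "branch_type R t i \<tau> \<Longrightarrow> rgen R False (branch (t + 2) i) + rgen R True (branch (t + 2) i) = bsum t \<tau>"
  unfolding branch_type_def by (cases \<tau>) (simp_all add: algebra_simps)

lemma branch_type_Child: "branch_type {Child i} t i RC"
  by (simp add: branch_type_def rgen_branch power2_eq_square mult_ac)

lemma branch_type_arm:
  assumes "j < t + 2"
  shows "branch_type {Inner i j} t i RI" "branch_type {Outer i j} t i RO"
    "branch_type {Child i, Outer i j} t i RCO"
proof -
  have *: "(\<Prod>k<t + 2. if k = j then x else c) = x * (c * c ^ t)" for x c :: "nat poly"
    using prod_all_but_one[of j "t + 1" "\<lambda>k. if k = j then x else c" c] assms by simp
  show "branch_type {Inner i j} t i RI" "branch_type {Outer i j} t i RO"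
    "branch_type {Child i, Outer i j} t i RCO"
    unfolding branch_type_def rgen_branch
    by (simp_all only: * vertex.inject vertex.distinct insert_iff empty_iff simp_thms if_True if_False lin.simps)
       (simp_all add: algebra_simps power2_eq_square)
qed

text \<open>A required inner vertex excludes the child. With the child excluded, requiring the inner
  or the outer vertex of another arm leaves the same factor \<open>X\<close>, so both kinds of pairs
  have type \<open>RII\<close>.\<close>

lemma branch_type_two_arms:
  assumes "j < t + 2" "k < t + 2" "j \<noteq> k"
  shows "branch_type {Inner i j, Inner i k} t i RII" "branch_type {Inner i j, Outer i k} t i RII"
    "branch_type {Outer i j, Outer i k} t i ROO"
proof -
  have *: "(\<Prod>l<t + 2. if l = j \<or> l = k then x else c) = x * x * c ^ t" for x c :: "nat poly"
    using prod_all_but_two[of j t k "\<lambda>l. if l = j \<or> l = k then x else c" c] assms by simp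
  have **: "(\<Prod>l<t + 2. if l = j then x else if l = k then y else c) = x * y * c ^ t"
    for x y c :: "nat poly"
    using prod_all_but_two[of j t k "\<lambda>l. if l = j then x else if l = k then y else c" c] assms
    by simp
  have "(if l = j then if l = k then 0 else x else if l = k then y else c) =
      (if l = j then x else if l = k then y else c)" for l and x y c :: "nat poly"
    using assms by auto
  note if_eq = this
  show "branch_type {Inner i j, Inner i k} t i RII" "branch_type {Inner i j, Outer i k} t i RII"
    "branch_type {Outer i j, Outer i k} t i ROO"
    unfolding branch_type_def rgen_branch
    by (simp_all only: * ** if_eq vertex.inject vertex.distinct insert_iff empty_iff simp_thms if_True if_False lin.simps)
       (simp_all add: algebra_simps power2_eq_square)
qed

text \<open>The third conclusion serves nonedges at the root. All children are then unselected, and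
  inner and outer vertices of an arm leave the same factor, so one check settles every such
  nonedge.\<close>

lemma branch_type_single:
  assumes "u \<in> set (labels (branch (t + 2) i))"
  obtains \<tau> where "\<tau> \<in> set singles" "branch_type {u} t i \<tau>"
    "u \<noteq> Child i \<Longrightarrow> bout t \<tau> = X * P2 * P2 ^ t"
proof -
  from assms consider "u = Child i" | j where "j < t + 2" "u = Inner i j"
    | j where "j < t + 2" "u = Outer i j"
    unfolding set_labels_branch by blast
  then show ?thesis
  proof cases
    case 1
    then show ?thesis
      using branch_type_Child by (intro that[of RC]) auto
  next
    case 2
    then show ?thesis
      using branch_type_arm(1) by (intro that[of RI]) (auto simp: mult.assoc)
  next
    case 3
    then show ?thesis
      using branch_type_arm(2) by (intro that[of RO]) (auto simp: mult.assoc)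
  qed
qed

lemma branch_type_double:
  assumes "u \<in> set (labels (branch (t + 2) i))" "v \<in> set (labels (branch (t + 2) i))"
    and "i < m" "u \<noteq> v" "{u, v} \<notin> edges (galvin_tree m (t + 2))"
  obtains \<tau> where "\<tau> \<in> set doubles" "branch_type {u, v} t i \<tau>"
proof -
  \<comment> \<open>These edges rule out a child with an inner vertex and the two ends of one arm;
    every remaining pair in the branch has a type in \<open>doubles\<close>.\<close>
  have E: "{Child i, Inner i j} \<in> edges (galvin_tree m (t + 2))"
    "{Inner i j, Outer i j} \<in> edges (galvin_tree m (t + 2))" if "j < t + 2" for j
    using that assms(3) by (auto simp: galvin_tree_def)
  have "\<exists>\<tau>\<in>set doubles. branch_type {u, v} t i \<tau>"
    using assms(1,2,4,5) E branch_type_arm(3)[of _ t i] branch_type_two_arms[of _ t _ i]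
    unfolding set_labels_branch
    by (auto simp: insert_commute) (metis insert_commute)+
  then show ?thesis
    using that by blast
qed

lemma disjoint_labels_branch: "i \<noteq> k \<Longrightarrow> set (labels (branch t i)) \<inter> set (labels (branch t k)) = {}"
  by (auto simp: set_labels_branch)

lemma Root_notin_labels_branch: "Root \<notin> set (labels (branch t i))"
  by (auto simp: set_labels_branch)

lemma verts_galvin_tree_cases:
  assumes "u \<in> verts (galvin_tree m t)" "u \<noteq> Root"
  obtains i where "i < m" "u \<in> set (labels (branch t i))"
  using assms by (auto simp: galvin_rtree_def simp flip: set_labels_galvin_rtree)

lemma rgen_branch_sum_free:
  assumes "R \<inter> set (labels (branch (t + 2) i)) = {}"
  shows "rgen R False (branch (t + 2) i) + rgen R True (branch (t + 2) i) = B t"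
  by (simp only: rgen_branch_free[OF assms] B_def)

lemma rgen_galvin_rtree_free:
  assumes "R \<inter> verts (galvin_tree m (t + 2)) = {}"
  shows "rgen R False (galvin_rtree m (t + 2)) = B t ^ m"
    "rgen R True (galvin_rtree m (t + 2)) = X * (P2 ^ (t + 2)) ^ m"
proof -
  have R: "R \<inter> set (labels (branch (t + 2) i)) = {}" if "i < m" for i
  proof -
    have "set (labels (branch (t + 2) i)) \<subseteq> verts (galvin_tree m (t + 2))"
      using that by (auto simp: galvin_rtree_def simp flip: set_labels_galvin_rtree)
    then show ?thesis
      using assms by blast
  qed
  have "Root \<notin> R"
    using assms by (auto simp: galvin_tree_def)
  moreover have "(\<Prod>i<m. rgen R False (branch (t + 2) i) + rgen R True (branch (t + 2) i)) = (\<Prod>i<m. B t)"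
    using R by (intro prod.cong refl rgen_branch_sum_free) (simp only: lessThan_iff)
  ultimately show "rgen R False (galvin_rtree m (t + 2)) = B t ^ m"
    by (simp add: rgen_galvin_rtree)
  have "(\<Prod>i<m. rgen R False (branch (t + 2) i)) = (\<Prod>i<m. P2 ^ (t + 2))"
    using R by (intro prod.cong refl rgen_branch_free) (simp only: lessThan_iff)
  then show "rgen R True (galvin_rtree m (t + 2)) = X * (P2 ^ (t + 2)) ^ m"
    by (simp add: rgen_galvin_rtree)
qed

lemma rgen_galvin_rtree_Root:
  "rgen {Root} False (galvin_rtree m (t + 2)) = 0"
  "rgen {Root} True (galvin_rtree m (t + 2)) = X * (P2 ^ (t + 2)) ^ m"
proof -
  have "{Root} \<inter> set (labels (branch (t + 2) i)) = {}" for i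
    using Root_notin_labels_branch by blast
  then show "rgen {Root} False (galvin_rtree m (t + 2)) = 0"
    "rgen {Root} True (galvin_rtree m (t + 2)) = X * (P2 ^ (t + 2)) ^ m"
    unfolding rgen_galvin_rtree
    by (simp_all add: rgen_branch_free del: add_2_eq_Suc' power_Suc)
qed

text \<open>The conditional lets the same lemma handle a pair consisting of the root and a vertex of
  a branch.\<close>

lemma rgen_galvin_rtree_branch:
  assumes "i < m + 1" "R \<inter> set (labels (branch (t + 2) i)) = R'" "branch_type R' t i \<tau>"
    and "\<And>k. k < m + 1 \<Longrightarrow> k \<noteq> i \<Longrightarrow> R \<inter> set (labels (branch (t + 2) k)) = {}"
  shows "rgen R False (galvin_rtree (m + 1) (t + 2)) = (if Root \<in> R then 0 else bsum t \<tau> * B t ^ m)"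
    "rgen R True (galvin_rtree (m + 1) (t + 2)) = X * (bout t \<tau> * (P2 ^ (t + 2)) ^ m)"
proof -
  have \<tau>: "branch_type R t i \<tau>"
    using assms(2,3) branch_type_cong[of R t i R' \<tau>] by blast
  have "(\<Prod>k<m + 1. rgen R False (branch (t + 2) k) + rgen R True (branch (t + 2) k)) = bsum t \<tau> * B t ^ m"
    unfolding branch_type_sum[OF \<tau>, symmetric]
    by (rule prod_all_but_one[OF assms(1)]) (rule rgen_branch_sum_free[OF assms(4)])
  then show "rgen R False (galvin_rtree (m + 1) (t + 2)) = (if Root \<in> R then 0 else bsum t \<tau> * B t ^ m)"
    unfolding rgen_galvin_rtree by (simp only:)
  have "(\<Prod>k<m + 1. rgen R False (branch (t + 2) k)) = bout t \<tau> * (P2 ^ (t + 2)) ^ m"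
    unfolding \<tau>[unfolded branch_type_def, THEN conjunct1, symmetric]
    by (rule prod_all_but_one[OF assms(1)]) (rule rgen_branch_free(1)[OF assms(4)])
  then show "rgen R True (galvin_rtree (m + 1) (t + 2)) = X * (bout t \<tau> * (P2 ^ (t + 2)) ^ m)"
    unfolding rgen_galvin_rtree by (simp only:)
qed

lemma rgen_galvin_rtree_two_branches:
  assumes "i < m + 2" "k < m + 2" "i \<noteq> k" "Root \<notin> R"
    and "R \<inter> set (labels (branch (t + 2) i)) = R'" "branch_type R' t i \<tau>"
    and "R \<inter> set (labels (branch (t + 2) k)) = R''" "branch_type R'' t k \<sigma>"
    and "\<And>l. l < m + 2 \<Longrightarrow> l \<noteq> i \<Longrightarrow> l \<noteq> k \<Longrightarrow> R \<inter> set (labels (branch (t + 2) l)) = {}"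
  shows "rgen R False (galvin_rtree (m + 2) (t + 2)) = bsum t \<tau> * bsum t \<sigma> * B t ^ m"
    "rgen R True (galvin_rtree (m + 2) (t + 2)) = X * (bout t \<tau> * bout t \<sigma> * (P2 ^ (t + 2)) ^ m)"
proof -
  have \<tau>: "branch_type R t i \<tau>"
    using assms(5,6) branch_type_cong[of R t i R' \<tau>] by blast
  have \<sigma>: "branch_type R t k \<sigma>"
    using assms(7,8) branch_type_cong[of R t k R'' \<sigma>] by blast
  have "(\<Prod>l<m + 2. rgen R False (branch (t + 2) l) + rgen R True (branch (t + 2) l)) =
      bsum t \<tau> * bsum t \<sigma> * B t ^ m"
    unfolding branch_type_sum[OF \<tau>, symmetric] branch_type_sum[OF \<sigma>, symmetric]
    by (rule prod_all_but_two[OF assms(1-3)]) (rule rgen_branch_sum_free[OF assms(9)])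
  then show "rgen R False (galvin_rtree (m + 2) (t + 2)) = bsum t \<tau> * bsum t \<sigma> * B t ^ m"
    unfolding rgen_galvin_rtree using assms(4) by (simp only: if_False)
  have "(\<Prod>l<m + 2. rgen R False (branch (t + 2) l)) = bout t \<tau> * bout t \<sigma> * (P2 ^ (t + 2)) ^ m"
    unfolding \<tau>[unfolded branch_type_def, THEN conjunct1, symmetric]
      \<sigma>[unfolded branch_type_def, THEN conjunct1, symmetric]
    by (rule prod_all_but_two[OF assms(1-3)]) (rule rgen_branch_free(1)[OF assms(9)])
  then show "rgen R True (galvin_rtree (m + 2) (t + 2)) = X * (bout t \<tau> * bout t \<sigma> * (P2 ^ (t + 2)) ^ m)"
    unfolding rgen_galvin_rtree by (simp only:)
qed

section \<open>Required vertices and nonedges of a whole Galvin tree\<close>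

lemma rgen_galvin_rtree_single:
  assumes "u \<in> verts (galvin_tree (m + 1) (t + 2))" "u \<noteq> Root"
  shows "(rgen {u} False (galvin_rtree (m + 1) (t + 2)), rgen {u} True (galvin_rtree (m + 1) (t + 2)))
    \<in> single_pairs m t"
proof -
  obtain i where i: "i < m + 1" "u \<in> set (labels (branch (t + 2) i))"
    using assms by (rule verts_galvin_tree_cases)
  obtain \<tau> where \<tau>: "\<tau> \<in> set singles" "branch_type {u} t i \<tau>"
    using i(2) by (rule branch_type_single)
  have "{u} \<inter> set (labels (branch (t + 2) i)) = {u}"
    using i(2) by blast
  moreover have "{u} \<inter> set (labels (branch (t + 2) k)) = {}" if "k \<noteq> i" for k
    using disjoint_labels_branch[OF that, of "t + 2"] i(2) by blast
  ultimately show ?thesis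
    using rgen_galvin_rtree_branch[OF i(1) _ \<tau>(2), of "{u}"] assms(2) \<tau>(1)
    unfolding single_pairs_def by auto
qed

lemma rgen_galvin_rtree_double:
  assumes "nonedge (galvin_tree (m + 2) (t + 2)) {u, v}"
  shows "(rgen {u, v} False (galvin_rtree (m + 2) (t + 2)), rgen {u, v} True (galvin_rtree (m + 2) (t + 2)))
    \<in> double_pairs m t"
proof -
  let ?V = "verts (galvin_tree (m + 2) (t + 2))" and ?L = "\<lambda>i. set (labels (branch (t + 2) i))"
  let ?P = "\<lambda>u v. (rgen {u, v} False (galvin_rtree (m + 2) (t + 2)),
    rgen {u, v} True (galvin_rtree (m + 2) (t + 2))) \<in> double_pairs m t"
  have uv: "u \<in> ?V" "v \<in> ?V" "u \<noteq> v" "{u, v} \<notin> edges (galvin_tree (m + 2) (t + 2))"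
    using assms by (auto simp: nonedge_def doubleton_eq_iff)
  have root: "?P Root v" if v: "v \<in> ?V" "v \<noteq> Root" "{Root, v} \<notin> edges (galvin_tree (m + 2) (t + 2))" for v
  proof -
    obtain i where i: "i < m + 2" "v \<in> ?L i"
      using v(1,2) by (rule verts_galvin_tree_cases)
    then have "v \<noteq> Child i"
      using v(3) by (auto simp: galvin_tree_def)
    with i(2) obtain \<tau> where \<tau>: "branch_type {v} t i \<tau>" "bout t \<tau> = X * P2 * P2 ^ t"
      by (metis branch_type_single)
    have L: "{Root, v} \<inter> ?L i = {v}"
      using i(2) Root_notin_labels_branch by blast
    have L': "{Root, v} \<inter> ?L k = {}" if "k \<noteq> i" for k
      using disjoint_labels_branch[OF that, of "t + 2"] i(2) Root_notin_labels_branch by blast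
    have i': "i < (m + 1) + 1" and m: "(m + 1) + 1 = m + 2"
      using i(1) by simp_all
    show ?thesis
      using rgen_galvin_rtree_branch[OF i' L \<tau>(1) L'] \<tau>(2)
      unfolding m double_pairs_def by simp
  qed
  show ?thesis
  proof (cases "u = Root \<or> v = Root")
    case True
    then show ?thesis
      using root[of u] root[of v] uv by (auto simp: insert_commute)
  next
    case False
    then have nR: "Root \<notin> {u, v}"
      by auto
    obtain i k where i: "i < m + 2" "u \<in> ?L i" and k: "k < m + 2" "v \<in> ?L k"
      using verts_galvin_tree_cases uv(1,2) False by metis
    show ?thesis
    proof (cases "i = k")
      case True
      obtain \<tau> where \<tau>: "\<tau> \<in> set doubles" "branch_type {u, v} t i \<tau>"
        using branch_type_double[of u t i v "m + 2"] i k uv True by metis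
      have L: "{u, v} \<inter> ?L i = {u, v}"
        using i k True by blast
      have L': "{u, v} \<inter> ?L l = {}" if "l \<noteq> i" for l
        using disjoint_labels_branch[OF that, of "t + 2"] i(2) k(2) True by blast
      have i': "i < (m + 1) + 1" and m: "(m + 1) + 1 = m + 2"
        using i(1) by simp_all
      have "(bsum t \<tau> * B t ^ (m + 1), X * (bout t \<tau> * (P2 ^ (t + 2)) ^ (m + 1))) \<in> double_pairs m t"
        unfolding double_pairs_def using \<tau>(1) by (intro UnI1 image_eqI[OF refl])
      then show ?thesis
        using rgen_galvin_rtree_branch[OF i' L \<tau>(2) L'] nR unfolding m
        by (simp only: if_False simp_thms)
    next
      case False
      obtain \<tau> where \<tau>: "\<tau> \<in> set singles" "branch_type {u} t i \<tau>"
        using i(2) by (rule branch_type_single)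
      obtain \<sigma> where \<sigma>: "\<sigma> \<in> set singles" "branch_type {v} t k \<sigma>"
        using k(2) by (rule branch_type_single)
      have L: "{u, v} \<inter> ?L i = {u}" "{u, v} \<inter> ?L k = {v}"
        using disjoint_labels_branch[OF False, of "t + 2"] i(2) k(2) by blast+
      have L': "{u, v} \<inter> ?L l = {}" if "l \<noteq> i" "l \<noteq> k" for l
        using disjoint_labels_branch[OF that(1), of "t + 2"] disjoint_labels_branch[OF that(2), of "t + 2"]
          i(2) k(2) by blast
      have "(bsum t \<tau> * bsum t \<sigma> * B t ^ m, X * (bout t \<tau> * bout t \<sigma> * (P2 ^ (t + 2)) ^ m)) \<in> double_pairs m t"
        unfolding double_pairs_def using \<tau>(1) \<sigma>(1)
        by (intro UnI1 UnI2 image_eqI[of _ _ "(\<tau>, \<sigma>)"]) (simp_all only: prod.case mem_Sigma_iff)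
      then show ?thesis
        using rgen_galvin_rtree_two_branches[OF i(1) k(1) False nR L(1) \<tau>(2) L(2) \<sigma>(2) L']
        by (simp only: simp_thms)
    qed
  qed
qed

lemma galvin_tree_unimodal_not_log_concave:
  assumes "galvin_check m t js" "nonedge (galvin_tree (m + 2) (t + 2)) e"
  shows "unimodal (independence_poly (add_edge (galvin_tree (m + 2) (t + 2)) e)) \<and>
    \<not> log_concave (independence_poly (add_edge (galvin_tree (m + 2) (t + 2)) e))"
proof -
  let ?G = "galvin_tree (m + 2) (t + 2)" and ?T = "galvin_rtree (m + 2) (t + 2)"
  obtain u v where e: "e = {u, v}" and uv: "u \<in> verts ?G" "v \<in> verts ?G"
    using assms(2) by (auto simp: nonedge_def)
  have G: "finite_simple_graph ?G"
    by (rule finite_simple_graph_galvin_tree)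
  have gen: "genfun {S. independent ?G S \<and> R \<subseteq> S} = rgen R False ?T + rgen R True ?T"
    if "R \<subseteq> verts ?G" for R
    using that
    by (intro genfun_rtree distinct_labels_galvin_rtree)
      (simp_all only: set_labels_galvin_rtree independent_iff[OF G] indep_galvin_rtree)
  have "independence_poly (add_edge ?G {u, v}) + (rgen {u, v} False ?T + rgen {u, v} True ?T) =
      rgen {} False ?T + rgen {} True ?T"
    using independence_poly_add_edge[OF G assms(2)[unfolded e]] gen[of "{u, v}"] gen[of "{}"] uv by simp
  moreover have "good (rgen {} False ?T + rgen {} True ?T) (rgen {u, v} False ?T + rgen {u, v} True ?T)"
    using galvin_check_sound[OF assms(1) rgen_galvin_rtree_double[OF assms(2)[unfolded e]]]
    by (simp only: rgen_galvin_rtree_free[of "{}", OF Int_empty_left])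
  ultimately show ?thesis
    unfolding good_def e by blast
qed

section \<open>Bautista--Ramos trees\<close>

definition bautista_ramos_rtree :: "nat \<Rightarrow> nat \<Rightarrow> vertex rtree" where
  "bautista_ramos_rtree m t = Node Apex
     (Node Pendant [] # map (\<lambda>k. map_rtree (Copy k) (galvin_rtree 3 t)) [0..<m])"

lemma set_labels_bautista_ramos_rtree:
  "set (labels (bautista_ramos_rtree m t)) = verts (bautista_ramos_tree m t)"
  by (auto simp: bautista_ramos_rtree_def bautista_ramos_tree_def labels_map_rtree
      set_labels_galvin_rtree)

lemma distinct_labels_bautista_ramos_rtree: "distinct (labels (bautista_ramos_rtree m t))"
proof -
  have "distinct (concat (map (\<lambda>k. map (Copy k) (labels (galvin_rtree 3 t))) [0..<m]))"
    by (rule distinct_concat_map) (auto simp: distinct_map distinct_labels_galvin_rtree inj_on_def)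
  then show ?thesis
    by (auto simp: bautista_ramos_rtree_def labels_map_rtree comp_def)
qed

lemma indep_bautista_ramos_rtree:
  "indep S (bautista_ramos_rtree m t) \<longleftrightarrow> (\<forall>e\<in>edges (bautista_ramos_tree m t). \<not> e \<subseteq> S)"
proof -
  have *: "(\<forall>e\<in>{f k e | k e. k < m \<and> e \<in> E}. Q e) \<longleftrightarrow> (\<forall>k<m. \<forall>e\<in>E. Q (f k e))"
    "(\<forall>e\<in>{g k | k. k < m}. Q e) \<longleftrightarrow> (\<forall>k<m. Q (g k))"
    for f g and E :: "vertex set set" and Q :: "vertex set \<Rightarrow> bool"
    by blast+
  have root: "root (galvin_rtree 3 t) = Root"
    by (simp add: galvin_rtree_def)
  show ?thesis
    unfolding bautista_ramos_tree_def snd_conv ball_Un *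
    by (auto simp: bautista_ramos_rtree_def indep_map_rtree rtree.map_sel root
        indep_galvin_rtree image_subset_iff_subset_vimage)
qed

section \<open>Nonedges of Bautista--Ramos trees\<close>

lemma rgen_bautista_ramos_rtree:
  "rgen R False (bautista_ramos_rtree m t) = (if Apex \<in> R then 0 else
     (if Pendant \<in> R then X else P1) * (\<Prod>k<m. rgen (Copy k -` R) False (galvin_rtree 3 t) +
       rgen (Copy k -` R) True (galvin_rtree 3 t)))"
  "rgen R True (bautista_ramos_rtree m t) = (if Pendant \<in> R then 0 else
     X * (\<Prod>k<m. rgen (Copy k -` R) False (galvin_rtree 3 t)))"
  by (simp_all add: bautista_ramos_rtree_def rgen_map_rtree prod_list_upt comp_def P1_def)

lemma bautista_ramos_nonedge_good:
  assumes "bautista_ramos_check m t js" "nonedge (bautista_ramos_tree (m + 2) (t + 2)) {u, v}"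
  shows "good (P1 * D t ^ (m + 2) + X * B t ^ (3 * m + 6))
    (rgen {u, v} False (bautista_ramos_rtree (m + 2) (t + 2)) +
     rgen {u, v} True (bautista_ramos_rtree (m + 2) (t + 2)))"
proof -
  let ?G = "galvin_tree 3 (t + 2)" and ?T = "galvin_rtree 3 (t + 2)" and ?q = "P2 ^ (t + 2)"
  let ?E = "edges (bautista_ramos_tree (m + 2) (t + 2))"
  let ?F = "\<lambda>u v. rgen {u, v} False (bautista_ramos_rtree (m + 2) (t + 2)) +
     rgen {u, v} True (bautista_ramos_rtree (m + 2) (t + 2))"
  let ?A = "P1 * D t ^ (m + 2) + X * B t ^ (3 * m + 6)"
  let ?f = "\<lambda>R. rgen R False ?T" and ?g = "\<lambda>R. rgen R True ?T"
  let ?rt = "(0, X * ?q ^ 3)"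
  have free: "?f {} = B t ^ 3" "?g {} = X * ?q ^ 3" "?f {} + ?g {} = D t"
    by (simp_all only: rgen_galvin_rtree_free[of "{}", OF Int_empty_left] D_def)
  note sound = bautista_ramos_check_sound[OF assms(1)]
  have single: "(?f {x}, ?g {x}) \<in> single_pairs 2 t" if "x \<in> verts ?G" "x \<noteq> Root" for x
    using rgen_galvin_rtree_single[of x 2 t] that by simp
  have single': "(?f {x}, ?g {x}) \<in> insert ?rt (single_pairs 2 t)" if "x \<in> verts ?G" for x
    using single[OF that] rgen_galvin_rtree_Root[of 3 t] by (cases "x = Root") simp_all
  have pow: "(B t ^ 3) ^ m = B t ^ (3 * m)" "(B t ^ 3) ^ (m + 1) = B t ^ (3 * m + 3)"
    unfolding power_mult[symmetric] by (simp_all only: distrib_left mult_1_right)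
  have one: "(\<Prod>l<m + 2. f l) = f k * c ^ (m + 1)"
    if "k < m + 2" "\<And>l. l < m + 2 \<Longrightarrow> l \<noteq> k \<Longrightarrow> f l = c" for k c and f :: "nat \<Rightarrow> nat poly"
    using prod_all_but_one[of k "m + 1" f c] that by simp
  \<comment> \<open>A selected apex excludes the leaf and the roots of all copies, so only the parts
    without root enter. The root itself is adjacent to the apex, hence
    \<open>x \<noteq> Root\<close>.\<close>
  have apex: "good ?A (?F Apex (Copy k x))" if k: "k < m + 2" and x: "x \<in> verts ?G" "x \<noteq> Root" for k x
  proof -
    have "Copy l -` {Apex, Copy k x} = (if l = k then {x} else {})" for l
      by auto
    then have "(\<Prod>l<m + 2. ?f (Copy l -` {Apex, Copy k x})) = ?f {x} * B t ^ (3 * m + 3)"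
      by (subst one[OF k, of _ "B t ^ 3"]) (simp_all only: free pow if_True if_False simp_thms)
    then show ?thesis
      using sound(3)[OF single[OF x]]
      by (simp only: rgen_bautista_ramos_rtree insert_iff empty_iff vertex.distinct simp_thms
          if_True if_False add_0_left)
  qed
  \<comment> \<open>A selected leaf excludes the apex, which leaves the copies independent of each
    other.\<close>
  have pendant: "good ?A (?F Pendant (Copy k x))" if k: "k < m + 2" and x: "x \<in> verts ?G" for k x
  proof -
    have "Copy l -` {Pendant, Copy k x} = (if l = k then {x} else {})" for l
      by auto
    then have "(\<Prod>l<m + 2. ?f (Copy l -` {Pendant, Copy k x}) + ?g (Copy l -` {Pendant, Copy k x})) =
        (?f {x} + ?g {x}) * D t ^ (m + 1)"
      by (subst one[OF k, of _ "D t"]) (simp_all only: free(3) pow if_True if_False simp_thms)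
    then show ?thesis
      using sound(4)[OF single'[OF x]]
      by (simp only: rgen_bautista_ramos_rtree insert_iff empty_iff vertex.distinct simp_thms
          if_True if_False add_0_right)
  qed
  have same: "good ?A (?F (Copy k x) (Copy k y))" if k: "k < m + 2" and xy: "nonedge ?G {x, y}" for k x y
  proof -
    have vimage: "Copy l -` {Copy k x, Copy k y} = (if l = k then {x, y} else {})" for l
      by auto
    then have "(\<Prod>l<m + 2. ?f (Copy l -` {Copy k x, Copy k y}) + ?g (Copy l -` {Copy k x, Copy k y})) =
        (?f {x, y} + ?g {x, y}) * D t ^ (m + 1)"
      by (subst one[OF k, of _ "D t"]) (simp_all only: free(3) pow if_True if_False simp_thms)
    moreover have "(\<Prod>l<m + 2. ?f (Copy l -` {Copy k x, Copy k y})) = ?f {x, y} * B t ^ (3 * m + 3)"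
      using vimage by (subst one[OF k, of _ "B t ^ 3"]) (simp_all only: free pow if_True if_False simp_thms)
    moreover have "(?f {x, y}, ?g {x, y}) \<in> double_pairs 1 t"
      using rgen_galvin_rtree_double[of 1 t x y] xy by (simp only: one_plus_numeral add_num_simps)
    ultimately show ?thesis
      using sound(1)
      by (simp only: rgen_bautista_ramos_rtree insert_iff empty_iff vertex.distinct simp_thms
          if_True if_False add_0_right)
  qed
  have diff: "good ?A (?F (Copy k x) (Copy l y))"
    if kl: "k < m + 2" "l < m + 2" "k \<noteq> l" and xy: "x \<in> verts ?G" "y \<in> verts ?G" for k l x y
  proof -
    let ?R = "{Copy k x, Copy l y}"
    have vimage: "Copy n -` ?R = (if n = k then {x} else if n = l then {y} else {})" for n
      using kl(3) by auto
    then have "(\<Prod>n<m + 2. ?f (Copy n -` ?R) + ?g (Copy n -` ?R)) =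
        (?f {x} + ?g {x}) * (?f {y} + ?g {y}) * D t ^ m"
      using kl(3) kl(3)[symmetric]
      by (subst prod_all_but_two[OF kl, of _ "D t"]) (simp_all only: free(3) pow if_True if_False simp_thms)
    moreover have "(\<Prod>n<m + 2. ?f (Copy n -` ?R)) = ?f {x} * ?f {y} * B t ^ (3 * m)"
      using vimage kl(3) kl(3)[symmetric]
      by (subst prod_all_but_two[OF kl, of _ "B t ^ 3"]) (simp_all only: free pow if_True if_False simp_thms)
    ultimately show ?thesis
      using sound(2)[OF single'[OF xy(1)] single'[OF xy(2)]]
      by (simp only: rgen_bautista_ramos_rtree insert_iff empty_iff vertex.distinct simp_thms
          if_True if_False)
  qed
  have E: "{Apex, Pendant} \<in> ?E" "k < m + 2 \<Longrightarrow> {Apex, Copy k Root} \<in> ?E"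
    "k < m + 2 \<Longrightarrow> {x, y} \<in> edges ?G \<Longrightarrow> {Copy k x, Copy k y} \<in> ?E" for k x y
  proof -
    show "{Copy k x, Copy k y} \<in> ?E" if "k < m + 2" "{x, y} \<in> edges ?G"
    proof -
      have "Copy k ` {x, y} \<in> {Copy k ` e | k e. k < m + 2 \<and> e \<in> edges ?G}"
        using that by blast
      then show ?thesis
        by (simp add: bautista_ramos_tree_def)
    qed
  qed (auto simp: bautista_ramos_tree_def)
  \<comment> \<open>Apex and pendant leaf are adjacent, so every nonedge has an end in some copy; by
    symmetry this is \<open>v\<close>.\<close>
  have wlog: "good ?A (?F u v)"
    if "u \<noteq> v" "{u, v} \<notin> ?E" and u: "u = Apex \<or> u = Pendant \<or> (\<exists>k x. u = Copy k x \<and> k < m + 2 \<and> x \<in> verts ?G)"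
      and v: "\<exists>k x. v = Copy k x \<and> k < m + 2 \<and> x \<in> verts ?G" for u v
  proof -
    obtain l y where v: "v = Copy l y" "l < m + 2" "y \<in> verts ?G"
      using v by blast
    consider "u = Apex" | "u = Pendant" | k x where "u = Copy k x" "k < m + 2" "x \<in> verts ?G"
      using u by blast
    then show ?thesis
    proof cases
      case 1
      then show ?thesis
        using that(2) v E(2)[of l] by (metis apex)
    next
      case 2
      then show ?thesis
        using v by (simp only: pendant)
    next
      case 3
      show ?thesis
      proof (cases "k = l")
        case True
        then have "nonedge ?G {x, y}"
          using that(1,2) 3 v E(3)[of k x y] by (auto simp: nonedge_def)
        then show ?thesis
          using same[of k x y] 3 v True by (simp only:)
      next
        case False
        then show ?thesis
          using diff[OF 3(2) v(2) False 3(3) v(3)] 3(1) v(1) by (simp only:)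
      qed
    qed
  qed
  have uv: "u \<noteq> v" "{u, v} \<notin> ?E"
    and verts: "u \<in> verts (bautista_ramos_tree (m + 2) (t + 2))" "v \<in> verts (bautista_ramos_tree (m + 2) (t + 2))"
    using assms(2) by (auto simp: nonedge_def doubleton_eq_iff)
  have cases: "w = Apex \<or> w = Pendant \<or> (\<exists>k x. w = Copy k x \<and> k < m + 2 \<and> x \<in> verts ?G)"
    if "w \<in> verts (bautista_ramos_tree (m + 2) (t + 2))" for w
    using that by (auto simp: bautista_ramos_tree_def)
  show ?thesis
  proof (cases "\<exists>k x. v = Copy k x \<and> k < m + 2 \<and> x \<in> verts ?G")
    case True
    then show ?thesis
      using wlog[OF uv cases[OF verts(1)]] by blast
  next
    case False
    then have v: "v = Apex \<or> v = Pendant"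
      using cases[OF verts(2)] by blast
    have "u \<notin> {Apex, Pendant}"
      using uv v E(1) by (auto simp: insert_commute)
    then have "\<exists>k x. u = Copy k x \<and> k < m + 2 \<and> x \<in> verts ?G"
      using cases[OF verts(1)] by blast
    moreover have "v \<noteq> u" "{v, u} \<notin> ?E"
      using uv by (auto simp: insert_commute)
    ultimately have "good ?A (?F v u)"
      using wlog[of v u] v by blast
    then show ?thesis
      by (simp only: insert_commute)
  qed
qed

lemma bautista_ramos_tree_unimodal_not_log_concave:
  assumes "bautista_ramos_check m t js" "nonedge (bautista_ramos_tree (m + 2) (t + 2)) e"
  shows "unimodal (independence_poly (add_edge (bautista_ramos_tree (m + 2) (t + 2)) e)) \<and>
    \<not> log_concave (independence_poly (add_edge (bautista_ramos_tree (m + 2) (t + 2)) e))"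
proof -
  let ?G = "bautista_ramos_tree (m + 2) (t + 2)" and ?T = "bautista_ramos_rtree (m + 2) (t + 2)"
  obtain u v where e: "e = {u, v}" and uv: "u \<in> verts ?G" "v \<in> verts ?G"
    using assms(2) by (auto simp: nonedge_def)
  have G: "finite_simple_graph ?G"
    by (rule finite_simple_graph_bautista_ramos_tree)
  have gen: "genfun {S. independent ?G S \<and> R \<subseteq> S} = rgen R False ?T + rgen R True ?T"
    if "R \<subseteq> verts ?G" for R
    using that
    by (intro genfun_rtree distinct_labels_bautista_ramos_rtree)
      (simp_all only: set_labels_bautista_ramos_rtree independent_iff[OF G] indep_bautista_ramos_rtree)
  have pow: "(B t ^ 3) ^ (m + 2) = B t ^ (3 * m + 6)"
    unfolding power_mult[symmetric] by (rule arg_cong[where f = "power _"]) simp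
  have "rgen {} False ?T + rgen {} True ?T = P1 * D t ^ (m + 2) + X * B t ^ (3 * m + 6)"
    unfolding rgen_bautista_ramos_rtree vimage_empty rgen_galvin_rtree_free[of "{}", OF Int_empty_left]
      prod_constant card_lessThan pow D_def[symmetric] by simp
  moreover have "independence_poly (add_edge ?G {u, v}) + (rgen {u, v} False ?T + rgen {u, v} True ?T) =
      rgen {} False ?T + rgen {} True ?T"
    using independence_poly_add_edge[OF G assms(2)[unfolded e]] gen[of "{u, v}"] gen[of "{}"] uv by simp
  ultimately show ?thesis
    using bautista_ramos_nonedge_good[OF assms(1) assms(2)[unfolded e]]
    unfolding good_def e by metis
qed

section \<open>The certificates\<close>

text \<open>The first two arguments are m - 2 and t - 2 for \<open>galvin_tree m t\<close>. The
  listed index is m t + 1, the largest size of an independent set through the root; the violated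
  inequality is centred one further.\<close>

lemma galvin_check_4:
  "galvin_check 2 3 [21]"
  "galvin_check 2 4 [25]"
  "galvin_check 2 5 [29]"
  "galvin_check 2 6 [33]"
  "galvin_check 2 7 [37]"
  by (simp_all only: eval_simps)

lemma galvin_check_5:
  "galvin_check 3 3 [26]"
  "galvin_check 3 4 [31]"
  "galvin_check 3 5 [36]"
  "galvin_check 3 6 [41]"
  by (simp_all only: eval_simps)

lemma galvin_check_6:
  "galvin_check 4 3 [31]"
  "galvin_check 4 4 [37]"
  by (simp_all only: eval_simps)

text \<open>With m copies of \<open>galvin_tree 3 t\<close>, sets avoiding the apex and containing j
  roots have size at most 3 m (t + 1) + 1 - 2 j: a selected root leaves 3 t + 1 vertices in its copy
  instead of 3 (t + 1), and the leaf adds one. For m = 2 the listed indices are these bounds for j =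
  1 and j = 2; a failure at either is enough.\<close>

lemma bautista_ramos_check_2_6: "bautista_ramos_check 0 4 [41, 39]"
  by (simp only: eval_simps)

lemma bautista_ramos_check_2_7: "bautista_ramos_check 0 5 [47, 45]"
  by (simp only: eval_simps)

lemma bautista_ramos_check_2_8: "bautista_ramos_check 0 6 [53, 51]"
  by (simp only: eval_simps)

text \<open>For three copies of \<open>galvin_tree 3 t\<close> the index is the bound with two
  selected roots, 9 t + 6.\<close>

lemma bautista_ramos_check_3_6: "bautista_ramos_check 1 4 [60]"
  by (simp only: eval_simps)

lemma bautista_ramos_check_3_7: "bautista_ramos_check 1 5 [69]"
  by (simp only: eval_simps)

lemma bautista_ramos_check_3_8: "bautista_ramos_check 1 6 [78]"
  by (simp only: eval_simps)

theorem theorem5p1: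
  fixes T :: "vertex graph" and e :: "vertex set"
  assumes "T \<in> {galvin_tree 4 t | t. 5 \<le> t \<and> t \<le> 9}
             \<union> {galvin_tree 5 t | t. 5 \<le> t \<and> t \<le> 8}
             \<union> {galvin_tree 6 5, galvin_tree 6 6}
             \<union> {bautista_ramos_tree 2 t | t. 6 \<le> t \<and> t \<le> 8}
             \<union> {bautista_ramos_tree 3 t | t. 6 \<le> t \<and> t \<le> 8}"
    and "nonedge T e"
  shows "unimodal (independence_poly (add_edge T e))
       \<and> \<not> log_concave (independence_poly (add_edge T e))"
proof -
  have galvin: "?thesis" if "T = galvin_tree m' t'" "galvin_check m t js" "m' = m + 2" "t' = t + 2"
    for m t m' t' js
    using galvin_tree_unimodal_not_log_concave[OF that(2)] assms(2) unfolding that(1,3,4) by blast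
  have bautista_ramos: "?thesis"
    if "T = bautista_ramos_tree m' t'" "bautista_ramos_check m t js" "m' = m + 2" "t' = t + 2"
    for m t m' t' js
    using bautista_ramos_tree_unimodal_not_log_concave[OF that(2)] assms(2) unfolding that(1,3,4) by blast
  consider t where "T = galvin_tree 4 t" "5 \<le> t" "t \<le> 9"
    | t where "T = galvin_tree 5 t" "5 \<le> t" "t \<le> 8"
    | "T = galvin_tree 6 5" | "T = galvin_tree 6 6"
    | t where "T = bautista_ramos_tree 2 t" "6 \<le> t" "t \<le> 8"
    | t where "T = bautista_ramos_tree 3 t" "6 \<le> t" "t \<le> 8"
    using assms(1) by blast
  then show ?thesis
  proof cases
    case 1
    then consider "t = 5" | "t = 6" | "t = 7" | "t = 8" | "t = 9" by linarith
    then show ?thesis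
    proof cases
      case 1
      show ?thesis
        by (rule galvin[OF \<open>T = _\<close> galvin_check_4(1)]) (simp_all add: \<open>t = _\<close>)
    next
      case 2
      show ?thesis
        by (rule galvin[OF \<open>T = _\<close> galvin_check_4(2)]) (simp_all add: \<open>t = _\<close>)
    next
      case 3
      show ?thesis
        by (rule galvin[OF \<open>T = _\<close> galvin_check_4(3)]) (simp_all add: \<open>t = _\<close>)
    next
      case 4
      show ?thesis
        by (rule galvin[OF \<open>T = _\<close> galvin_check_4(4)]) (simp_all add: \<open>t = _\<close>)
    next
      case 5
      show ?thesis
        by (rule galvin[OF \<open>T = _\<close> galvin_check_4(5)]) (simp_all add: \<open>t = _\<close>)
    qed
  next
    case 2
    then consider "t = 5" | "t = 6" | "t = 7" | "t = 8" by linarith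
    then show ?thesis
    proof cases
      case 1
      show ?thesis
        by (rule galvin[OF \<open>T = _\<close> galvin_check_5(1)]) (simp_all add: \<open>t = _\<close>)
    next
      case 2
      show ?thesis
        by (rule galvin[OF \<open>T = _\<close> galvin_check_5(2)]) (simp_all add: \<open>t = _\<close>)
    next
      case 3
      show ?thesis
        by (rule galvin[OF \<open>T = _\<close> galvin_check_5(3)]) (simp_all add: \<open>t = _\<close>)
    next
      case 4
      show ?thesis
        by (rule galvin[OF \<open>T = _\<close> galvin_check_5(4)]) (simp_all add: \<open>t = _\<close>)
    qed
  next
    case 3
    show ?thesis
      by (rule galvin[OF 3 galvin_check_6(1)]) simp_all
  next
    case 4
    show ?thesis
      by (rule galvin[OF 4 galvin_check_6(2)]) simp_all
  next
    case 5
    then consider "t = 6" | "t = 7" | "t = 8" by linarith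
    then show ?thesis
    proof cases
      case 1
      show ?thesis
        by (rule bautista_ramos[OF \<open>T = _\<close> bautista_ramos_check_2_6]) (simp_all add: \<open>t = _\<close>)
    next
      case 2
      show ?thesis
        by (rule bautista_ramos[OF \<open>T = _\<close> bautista_ramos_check_2_7]) (simp_all add: \<open>t = _\<close>)
    next
      case 3
      show ?thesis
        by (rule bautista_ramos[OF \<open>T = _\<close> bautista_ramos_check_2_8]) (simp_all add: \<open>t = _\<close>)
    qed
  next
    case 6
    then consider "t = 6" | "t = 7" | "t = 8" by linarith
    then show ?thesis
    proof cases
      case 1
      show ?thesis
        by (rule bautista_ramos[OF \<open>T = _\<close> bautista_ramos_check_3_6]) (simp_all add: \<open>t = _\<close>)
    next
      case 2
      show ?thesis
        by (rule bautista_ramos[OF \<open>T = _\<close> bautista_ramos_check_3_7]) (simp_all add: \<open>t = _\<close>)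
    next
      case 3
      show ?thesis
        by (rule bautista_ramos[OF \<open>T = _\<close> bautista_ramos_check_3_8]) (simp_all add: \<open>t = _\<close>)
    qed
  qed
qed

end
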